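(* Let $\mathcal{H}_B$ be a complex Hilbert space with identity operator $\mathbb{I}_B$, and let $\{M_{(r,b)}\}_{r\in\{z,x\},\,b\in\{0,1\}}$ be a set of POVM elements of BB84 type on $\mathcal{H}_B$. Suppose that $\{M_{(r,b)}\}$ is $C_4$-symmetric, i.e. there exist $k\in\mathbb{N}$, $k\ge 1$, and a unitary operator $U$ on $\mathcal{H}_B$ with $U^{4k}=\mathbb{I}_B$ such that $$U M_{(z,b)}U^\dagger=M_{(x,b)}\ \text{ for } b=0,1,\qquad U^2M_{(r,b)}(U^{\dagger})^{2}=M_{(r,1-b)}\ \text{ for } r\in\{z,x\},\ b=0,1 .$$ Suppose further that the observable $M_z:=M_{(z,0)}-M_{(z,1)}$ (or equivalently $M_x:=M_{(x,0)}-M_{(x,1)}$) has rank two. Then there exists a squash operator for $\{M_{(r,b)}\}$ compatible with the BB84 protocol.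
   Context: A set of POVM elements of BB84 type on a Hilbert space $\mathcal{H}_B$ is a family of four positive semidefinite operators $M_{(r,b)}$ on $\mathcal{H}_B$, indexed by the basis $r\in\{z,x\}$ and the output bit $b\in\{0,1\}$, such that $M_{(r,0)}+M_{(r,1)}=\mathbb{I}_B$ for each $r\in\{z,x\}$. The associated observables are $M_r:=M_{(r,0)}-M_{(r,1)}$, $r=z,x$. Let $\mathcal{H}_C=\mathbb{C}^2$ be the qubit space, with Pauli matrices $\sigma_z=\begin{pmatrix}1&0\\0&-1\end{pmatrix}$ and $\sigma_x=\begin{pmatrix}0&1\\1&0\end{pmatrix}$. A squash operator for $\{M_{(r,b)}\}$ (compatible with the BB84 protocol) is a completely positive trace-preserving map $F$ from states on $\mathcal{H}_B$ to states on $\mathcal{H}_C$ such that, for every mixed state (density operator) $\rho_B$ on $\mathcal{H}_B$, $\mathrm{Tr}(F(\rho_B)\sigma_r)=\mathrm{Tr}(\rho_B M_r)$ for $r=z,x$. Equivalently, there are Kraus operators $F_c:\mathcal{H}_B\to\mathcal{H}_C$ with $\sum_c F_c^\dagger\sigma_r F_c=M_r$ for $r=z,x$ and $\sum_c F_c^\dagger F_c=\mathbb{I}_B$ (and then $F(\rho_B)=\sum_c F_c\rho_B F_c^\dagger$). *)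

theory Defs
  imports "HOL-Analysis.Analysis" "HOL-Library.Z2"
begin

section \<open>Complex Hilbert spaces\<close>

text \<open>
  A complex inner product space is built on top of the library's real one, so that norm, topology
  and real scalar multiplication are those of the library. The real inner product is the real part
  of the complex one, which is conjugate-linear in its first argument.
\<close>

class complex_inner = real_inner +
  fixes scaleC :: "complex \<Rightarrow> 'a \<Rightarrow> 'a" (infixr "*\<^sub>C" 75)
    and cinner :: "'a \<Rightarrow> 'a \<Rightarrow> complex"
  assumes scaleC_add_right: "c *\<^sub>C (x + y) = c *\<^sub>C x + c *\<^sub>C y"
    and scaleC_add_left: "(c + d) *\<^sub>C x = c *\<^sub>C x + d *\<^sub>C x"
    and scaleC_scaleC: "c *\<^sub>C d *\<^sub>C x = (c * d) *\<^sub>C x"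
    and scaleC_of_real: "complex_of_real r *\<^sub>C x = r *\<^sub>R x"
    and cinner_commute: "cinner x y = cnj (cinner y x)"
    and cinner_add_right: "cinner x (y + z) = cinner x y + cinner x z"
    and cinner_scaleC_right: "cinner x (c *\<^sub>C y) = c * cinner x y"
    and Re_cinner: "Re (cinner x y) = inner x y"

class chilbert_space = complex_inner + banach

lemma vector_space_scaleC:
  "vector_space (scaleC :: complex \<Rightarrow> 'a \<Rightarrow> 'a::complex_inner)"
proof
  show "1 *\<^sub>C x = x" for x :: 'a
    using scaleC_of_real[of 1 x] by simp
qed (simp_all add: scaleC_add_right scaleC_add_left scaleC_scaleC)

instantiation complex :: chilbert_space
begin
definition scaleC_complex :: "complex \<Rightarrow> complex \<Rightarrow> complex"
  where "scaleC_complex c x = c * x"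
definition cinner_complex :: "complex \<Rightarrow> complex \<Rightarrow> complex"
  where "cinner_complex x y = cnj x * y"
instance
  by standard
    (simp_all add: scaleC_complex_def cinner_complex_def algebra_simps scaleR_conv_of_real
      inner_complex_def)
end

instantiation vec :: (complex_inner, finite) complex_inner
begin
definition scaleC_vec :: "complex \<Rightarrow> 'a ^ 'b \<Rightarrow> 'a ^ 'b"
  where "scaleC_vec c x = (\<chi> i. c *\<^sub>C (x $ i))"
definition cinner_vec :: "'a ^ 'b \<Rightarrow> 'a ^ 'b \<Rightarrow> complex"
  where "cinner_vec x y = (\<Sum>i\<in>UNIV. cinner (x $ i) (y $ i))"
instance
proof
  show "cinner x y = cnj (cinner y x)" for x y :: "'a ^ 'b"
    unfolding cinner_vec_def by (subst cinner_commute) simp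
qed (simp_all add: scaleC_vec_def cinner_vec_def vec_eq_iff scaleC_add_right scaleC_add_left
      scaleC_scaleC scaleC_of_real cinner_add_right cinner_scaleC_right Re_cinner
      sum.distrib sum_distrib_left inner_vec_def)
end

instance vec :: (chilbert_space, finite) chilbert_space ..


section \<open>Operators\<close>

definition bounded_clinear :: "('a::complex_inner \<Rightarrow> 'b::complex_inner) \<Rightarrow> bool"
  where "bounded_clinear A \<longleftrightarrow> bounded_linear A \<and> (\<forall>c x. A (c *\<^sub>C x) = c *\<^sub>C A x)"

definition cadjoint :: "('a::complex_inner \<Rightarrow> 'b::complex_inner) \<Rightarrow> ('b \<Rightarrow> 'a)"
  where "cadjoint A = (SOME B. \<forall>x y. cinner (A x) y = cinner x (B y))"

definition positive_op :: "('a::complex_inner \<Rightarrow> 'a) \<Rightarrow> bool"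
  where "positive_op A \<longleftrightarrow> bounded_clinear A \<and> (\<forall>x. cinner x (A x) \<in> \<real>\<^sub>\<ge>\<^sub>0)"

definition unitary_op :: "('a::complex_inner \<Rightarrow> 'a) \<Rightarrow> bool"
  where "unitary_op U \<longleftrightarrow>
    bounded_clinear U \<and> surj U \<and> (\<forall>x y. cinner (U x) (U y) = cinner x y)"

text \<open>
  The complex dimension of the range. The library's \<open>dim\<close> is \<open>0\<close> on infinite-dimensional spaces,
  so a positive value means that the range really has that finite dimension.
\<close>

definition op_rank :: "('a::complex_inner \<Rightarrow> 'b::complex_inner) \<Rightarrow> nat"
  where "op_rank A = vector_space.dim scaleC (range A)"


section \<open>Trace and density operators\<close>

definition is_onb :: "'a::complex_inner set \<Rightarrow> bool"
  where "is_onb E \<longleftrightarrow>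
    (\<forall>e\<in>E. \<forall>f\<in>E. cinner e f = (if e = f then 1 else 0)) \<and>
    closure (module.span scaleC E) = UNIV"

text \<open>
  The Hilbert space may be infinite-dimensional, even non-separable. A bounded operator is trace
  class iff its diagonal is (absolutely) summable in every orthonormal basis, and the sum is then
  independent of the basis; see e.g. B. Simon, Trace Ideals and Their Applications, Chapter 3.
  In finite dimension every operator is trace class.
\<close>

definition has_op_trace :: "('a::complex_inner \<Rightarrow> 'a) \<Rightarrow> complex \<Rightarrow> bool"
  where "has_op_trace T t \<longleftrightarrow>
    (\<forall>E. is_onb E \<longrightarrow> ((\<lambda>e. cinner e (T e)) has_sum t) E)"

definition trace_class_op :: "('a::complex_inner \<Rightarrow> 'a) \<Rightarrow> bool"
  where "trace_class_op T \<longleftrightarrow> bounded_clinear T \<and> (\<exists>t. has_op_trace T t)"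

definition density_op :: "('a::complex_inner \<Rightarrow> 'a) \<Rightarrow> bool"
  where "density_op \<rho> \<longleftrightarrow> positive_op \<rho> \<and> has_op_trace \<rho> 1"


section \<open>Completely positive trace-preserving maps\<close>

text \<open>
  An operator on the tensor product of \<open>H\<close> with the \<open>n\<close>-dimensional space is an \<open>n\<close> by \<open>n\<close> block
  matrix of operators on \<open>H\<close>, and a linear map tensored with the identity acts blockwise.
  Only the blocks with indices below \<open>n\<close> are relevant.
\<close>

definition block_positive :: "nat \<Rightarrow> (nat \<Rightarrow> nat \<Rightarrow> 'a::complex_inner \<Rightarrow> 'a) \<Rightarrow> bool"
  where "block_positive n T \<longleftrightarrow>
    (\<forall>x. (\<Sum>i<n. \<Sum>j<n. cinner (x i) (T i j (x j))) \<in> \<real>\<^sub>\<ge>\<^sub>0)"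

text \<open>
  Maps from the trace class operators on \<open>'a\<close> to the operators (matrices) on \<open>complex ^ 'n\<close>; the
  values of \<open>F\<close> outside of the trace class are irrelevant.
\<close>

definition clinear_on_trace_class ::
  "(('a::complex_inner \<Rightarrow> 'a) \<Rightarrow> complex ^ 'n ^ 'n) \<Rightarrow> bool"
  where "clinear_on_trace_class F \<longleftrightarrow>
    (\<forall>S T. trace_class_op S \<and> trace_class_op T \<longrightarrow> F (\<lambda>x. S x + T x) = F S + F T) \<and>
    (\<forall>c T. trace_class_op T \<longrightarrow> F (\<lambda>x. c *\<^sub>C T x) = c *\<^sub>C F T)"

definition completely_positive ::
  "(('a::complex_inner \<Rightarrow> 'a) \<Rightarrow> complex ^ 'n ^ 'n) \<Rightarrow> bool"
  where "completely_positive F \<longleftrightarrow>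
    (\<forall>n T. (\<forall>i<n. \<forall>j<n. trace_class_op (T i j)) \<and> block_positive n T \<longrightarrow>
       block_positive n (\<lambda>i j v. F (T i j) *v v))"

definition trace_preserving ::
  "(('a::complex_inner \<Rightarrow> 'a) \<Rightarrow> complex ^ 'n ^ 'n) \<Rightarrow> bool"
  where "trace_preserving F \<longleftrightarrow> (\<forall>T. trace_class_op T \<longrightarrow> has_op_trace T (trace (F T)))"

definition cptp :: "(('a::complex_inner \<Rightarrow> 'a) \<Rightarrow> complex ^ 'n ^ 'n) \<Rightarrow> bool"
  where "cptp F \<longleftrightarrow>
    clinear_on_trace_class F \<and> completely_positive F \<and> trace_preserving F"


section \<open>BB84 measurements and squash operators\<close>

datatype bb84_basis = z_basis | x_basis

text \<open>The output bit is an element of the two-element field, so that \<open>1 - b\<close> is the flipped bit.\<close>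

definition bb84_povm :: "(bb84_basis \<times> bit \<Rightarrow> 'a::complex_inner \<Rightarrow> 'a) \<Rightarrow> bool"
  where "bb84_povm M \<longleftrightarrow>
    (\<forall>r b. positive_op (M (r, b))) \<and> (\<forall>r. (\<lambda>x. M (r, 0) x + M (r, 1) x) = id)"

definition observable ::
  "(bb84_basis \<times> bit \<Rightarrow> 'a::complex_inner \<Rightarrow> 'a) \<Rightarrow> bb84_basis \<Rightarrow> 'a \<Rightarrow> 'a"
  where "observable M r = (\<lambda>x. M (r, 0) x - M (r, 1) x)"

definition c4_symmetric :: "(bb84_basis \<times> bit \<Rightarrow> 'a::complex_inner \<Rightarrow> 'a) \<Rightarrow> bool"
  where "c4_symmetric M \<longleftrightarrow>
    (\<exists>(k::nat) U. k \<ge> 1 \<and> unitary_op U \<and> U ^^ (4 * k) = id \<and>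
       (\<forall>b. U \<circ> M (z_basis, b) \<circ> cadjoint U = M (x_basis, b)) \<and>
       (\<forall>r b. U ^^ 2 \<circ> M (r, b) \<circ> cadjoint U ^^ 2 = M (r, 1 - b)))"

fun pauli :: "bb84_basis \<Rightarrow> complex ^ 2 ^ 2"
  where
    "pauli z_basis = vector [vector [1, 0], vector [0, - 1]]"
  | "pauli x_basis = vector [vector [0, 1], vector [1, 0]]"

definition squash_operator ::
  "(bb84_basis \<times> bit \<Rightarrow> 'a::complex_inner \<Rightarrow> 'a) \<Rightarrow> (('a \<Rightarrow> 'a) \<Rightarrow> complex ^ 2 ^ 2) \<Rightarrow> bool"
  where "squash_operator M F \<longleftrightarrow> cptp F \<and>
    (\<forall>\<rho> r. density_op \<rho> \<longrightarrow> has_op_trace (\<rho> \<circ> observable M r) (trace (F \<rho> ** pauli r)))"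

end

theory Submission
  imports Defs
begin

text \<open>
  By symmetry \<open>M\<^sub>z = l (|p\<rangle>\<langle>q| + |q\<rangle>\<langle>p|)\<close> with \<open>0 < l \<le> 1\<close> and orthonormal eigenvectors \<open>p\<close>, \<open>q\<close> of
  \<open>U\<^sup>2\<close> whose eigenvalues are opposite. After rescaling \<open>U\<close> by a phase these are \<open>1\<close> and \<open>- 1\<close>, so
  that \<open>p\<close> splits into eigenvectors of \<open>U\<close> for \<open>\<plusminus> 1\<close>, and \<open>q\<close> into eigenvectors for \<open>\<plusminus> \<i>\<close>. In terms
  of these four orthogonal vectors, \<open>M\<^sub>z + \<i> M\<^sub>x\<close> is a weighted shift along a four-cycle, whereas
  \<open>\<sigma>\<^sub>z + \<i> \<sigma>\<^sub>x\<close> is twice a shift between two orthonormal vectors of the qubit: every edge of the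
  cycle yields a Kraus operator of rank two. Their total weight at each vertex is \<open>l\<close>, and the
  weight \<open>1 - l\<close> that is missing there, as well as the orthogonal complement of the four vectors,
  is mapped to the maximally mixed qubit.
\<close>

interpretation cvec: vector_space "scaleC :: complex \<Rightarrow> 'a \<Rightarrow> 'a::complex_inner"
  by (rule vector_space_scaleC)

section \<open>Orthonormal bases\<close>

lemma cinner_add_left: "cinner (x + y) z = cinner x z + cinner y z"
  by (metis cinner_add_right cinner_commute complex_cnj_add)

lemma cinner_scaleC_left: "cinner (c *\<^sub>C x) y = cnj c * cinner x y"
  by (metis cinner_commute cinner_scaleC_right complex_cnj_mult)

lemma cinner_zero_right [simp]: "cinner x 0 = 0"
  using cinner_add_right[of x 0 0] by simp

lemma cinner_zero_left [simp]: "cinner 0 x = 0"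
  using cinner_add_left[of 0 0 x] by simp

lemma cinner_minus_right: "cinner x (- y) = - cinner x y"
  using cinner_add_right[of x y "- y"] by (simp add: eq_neg_iff_add_eq_0 add.commute)

lemma cinner_minus_left: "cinner (- x) y = - cinner x y"
  using cinner_add_left[of x "- x" y] by (simp add: eq_neg_iff_add_eq_0 add.commute)

lemma cinner_diff_right: "cinner x (y - z) = cinner x y - cinner x z"
  using cinner_add_right[of x y "- z"] by (simp add: cinner_minus_right)

lemma cinner_diff_left: "cinner (x - y) z = cinner x z - cinner y z"
  using cinner_add_left[of x "- y" z] by (simp add: cinner_minus_left)

lemma cinner_scaleR_right: "cinner x (r *\<^sub>R y) = of_real r * cinner x y"
  by (metis cinner_scaleC_right scaleC_of_real)

lemma cinner_scaleR_left: "cinner (r *\<^sub>R x) y = of_real r * cinner x y"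
  by (metis cinner_scaleC_left complex_cnj_complex_of_real scaleC_of_real)

lemma cinner_sum_right: "cinner x (sum f A) = (\<Sum>i\<in>A. cinner x (f i))"
  by (induction A rule: infinite_finite_induct) (auto simp: cinner_add_right)

lemma cinner_self: "cinner x x = of_real ((norm x)\<^sup>2)"
proof (rule complex_eqI)
  show "Re (cinner x x) = Re (of_real ((norm x)\<^sup>2))"
    by (simp add: Re_cinner power2_norm_eq_inner)
  have "Im (cinner x x) = - Im (cinner x x)"
    using cinner_commute[of x x] by (metis cnj.simps(2))
  then show "Im (cinner x x) = Im (of_real ((norm x)\<^sup>2))" by simp
qed

lemma cinner_self_eq_0 [simp]: "cinner x x = 0 \<longleftrightarrow> x = 0"
  by (simp add: cinner_self)

lemma cinner_ext_right:
  assumes "\<And>z. cinner z x = cinner z y"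
  shows "x = y"
  using assms[of "x - y"] cinner_self_eq_0[of "x - y"] by (simp add: cinner_diff_right)

lemma norm_scaleC: "norm (c *\<^sub>C x) = cmod c * norm (x :: 'a::complex_inner)"
proof -
  have "complex_of_real ((norm (c *\<^sub>C x))\<^sup>2) = (cnj c * c) * of_real ((norm x)\<^sup>2)"
    unfolding cinner_self[symmetric] by (simp add: cinner_scaleC_left cinner_scaleC_right)
  also have "cnj c * c = of_real ((cmod c)\<^sup>2)"
    by (simp only: complex_norm_square mult.commute)
  finally have "complex_of_real ((norm (c *\<^sub>C x))\<^sup>2) = complex_of_real ((cmod c * norm x)\<^sup>2)"
    by (simp add: power_mult_distrib)
  then have "(norm (c *\<^sub>C x))\<^sup>2 = (cmod c * norm x)\<^sup>2"
    by (simp only: of_real_eq_iff)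
  then show ?thesis by (simp add: power2_eq_iff_nonneg)
qed

text \<open>Multiplying \<open>y\<close> by a phase makes the inner product real and nonnegative, so
  the real Cauchy-Schwarz inequality applies.\<close>

lemma norm_cinner_le: "cmod (cinner x y) \<le> norm x * norm y"
proof (cases "cinner x y = 0")
  case False
  define c where "c = cnj (sgn (cinner x y))"
  have c: "cmod c = 1" using False by (simp add: c_def norm_sgn)
  have "complex_of_real (cmod (cinner x y)) = cinner x (c *\<^sub>C y)"
    unfolding cinner_scaleC_right c_def sgn_eq using False
    by (simp add: field_simps complex_norm_square[symmetric] power2_eq_square)
  then have "cmod (cinner x y) = Re (cinner x (c *\<^sub>C y))"
    by (metis Re_complex_of_real)
  also have "\<dots> \<le> norm x * norm (c *\<^sub>C y)"
    unfolding Re_cinner by (rule norm_cauchy_schwarz)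
  finally show ?thesis by (simp add: norm_scaleC c)
qed auto

lemma bounded_linear_cinner_right: "bounded_linear (cinner x)"
  by (rule bounded_linear_intro[of _ "norm x"])
    (use norm_cinner_le[of x] in \<open>auto simp: cinner_add_right cinner_scaleR_right scaleR_conv_of_real mult.commute\<close>)

section \<open>Existence of orthonormal bases containing a given orthonormal set\<close>

definition orthonormal :: "'a::complex_inner set \<Rightarrow> bool"
  where "orthonormal E \<longleftrightarrow> (\<forall>e\<in>E. \<forall>f\<in>E. cinner e f = (if e = f then 1 else 0))"

lemma orthonormal_mono: "orthonormal E \<Longrightarrow> F \<subseteq> E \<Longrightarrow> orthonormal F"
  unfolding orthonormal_def by blast

lemma onb_orthonormal: "is_onb E \<Longrightarrow> orthonormal E"
  by (simp add: is_onb_def orthonormal_def)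

text \<open>The projection theorem: \<open>z\<close> is the residual of the point of the closed span
  nearest to \<open>x\<close>. Completeness enters through the convergence of a minimising
  sequence.\<close>

lemma nearest_point_orthogonal:
  fixes x :: "'a::chilbert_space"
  assumes "x \<notin> closure (cvec.span E)"
  obtains z where "z \<noteq> 0" "\<And>e. e \<in> E \<Longrightarrow> cinner e z = 0"
proof -
  let ?S = "cvec.span E"
  define D where "D = (INF y\<in>?S. (norm (x - y))\<^sup>2)"
  have S0: "0 \<in> ?S" by (rule cvec.span_zero)
  have bdd: "bdd_below ((\<lambda>y. (norm (x - y))\<^sup>2) ` ?S)"
    by (rule bdd_belowI[of _ 0]) auto
  have D_le: "D \<le> (norm (x - y))\<^sup>2" if "y \<in> ?S" for y
    unfolding D_def using that by (intro cINF_lower bdd)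
  have "\<exists>y\<in>?S. (norm (x - y))\<^sup>2 < D + 1 / real (Suc n)" for n
  proof -
    have "D < D + 1 / real (Suc n)" by simp
    then show ?thesis
      using cINF_less_iff[OF _ bdd] S0 unfolding D_def by blast
  qed
  then obtain y where y: "\<And>n. y n \<in> ?S" "\<And>n. (norm (x - y n))\<^sup>2 < D + 1 / real (Suc n)"
    by metis
  have par: "(norm (y m - y n))\<^sup>2 \<le> 2 / real (Suc m) + 2 / real (Suc n)" for m n
  proof -
    \<comment> \<open>The midpoint also has squared distance at least \<open>D\<close> from
      \<open>x\<close>, so the parallelogram law bounds the gap between two nearly optimal
      points.\<close>
    have mid: "(1/2) *\<^sub>R (y m + y n) \<in> ?S"
      unfolding scaleC_of_real[symmetric]
      by (intro cvec.span_scale cvec.span_add y)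
    have "(norm (y m - y n))\<^sup>2 = 2 * (norm (x - y m))\<^sup>2 + 2 * (norm (x - y n))\<^sup>2
        - 4 * (norm (x - (1/2) *\<^sub>R (y m + y n)))\<^sup>2"
      by (simp add: power2_norm_eq_inner inner_diff_left inner_diff_right inner_add_left
          inner_add_right inner_commute algebra_simps)
    then show ?thesis using D_le[OF mid] y(2)[of m] y(2)[of n] by simp
  qed
  have "Cauchy y"
  proof (rule metric_CauchyI)
    fix e :: real assume e: "e > 0"
    obtain N where N: "1 / real (Suc N) < e\<^sup>2 / 4"
      using nat_approx_posE[of "e\<^sup>2 / 4"] e by auto
    have "dist (y m) (y n) < e" if "m \<ge> N" "n \<ge> N" for m n
    proof -
      have "1 / real (Suc m) \<le> 1 / real (Suc N)" "1 / real (Suc n) \<le> 1 / real (Suc N)"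
        using that by (auto simp: field_simps)
      then have "(norm (y m - y n))\<^sup>2 < e\<^sup>2" using par[of m n] N by simp
      then show ?thesis using e by (simp add: dist_norm power_less_imp_less_base)
    qed
    then show "\<exists>N. \<forall>m\<ge>N. \<forall>n\<ge>N. dist (y m) (y n) < e" by blast
  qed
  then obtain y0 where lim: "y \<longlonglongrightarrow> y0"
    using convergent_eq_Cauchy by blast
  define z where "z = x - y0"
  have "y0 \<in> closure ?S" using lim y(1) closure_sequential by blast
  then have z0: "z \<noteq> 0" using assms by (auto simp: z_def)
  have zD: "(norm z)\<^sup>2 \<le> D"
  proof (rule LIMSEQ_le)
    show "(\<lambda>n. (norm (x - y n))\<^sup>2) \<longlonglongrightarrow> (norm z)\<^sup>2"
      unfolding z_def by (intro tendsto_power tendsto_norm tendsto_diff tendsto_const lim)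
    show "(\<lambda>n. D + inverse (real (Suc n))) \<longlonglongrightarrow> D"
      by (rule LIMSEQ_inverse_real_of_nat_add)
    show "\<exists>N. \<forall>n\<ge>N. (norm (x - y n))\<^sup>2 \<le> D + inverse (real (Suc n))"
      using y(2) less_imp_le by (auto simp: inverse_eq_divide)
  qed
  have orth: "cinner e z = 0" if e: "e \<in> E" for e
  proof (cases "e = 0")
    case False
    then have n0: "(norm e)\<^sup>2 \<noteq> 0" by simp
    \<comment> \<open>\<open>c *\<^sub>C e\<close> is the component of \<open>z\<close> along
      \<open>e\<close>. Moving \<open>y0\<close> by it would lower the squared distance by
      \<open>(cmod c)\<^sup>2 * (norm e)\<^sup>2\<close>, and minimality forces
      \<open>c = 0\<close>.\<close>
    define c where "c = cinner e z / of_real ((norm e)\<^sup>2)"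
    have mem: "y n + c *\<^sub>C e \<in> ?S" for n
      by (intro cvec.span_add cvec.span_scale cvec.span_base y e)
    have lim2: "(\<lambda>n. (norm (x - (y n + c *\<^sub>C e)))\<^sup>2) \<longlonglongrightarrow> (norm (x - (y0 + c *\<^sub>C e)))\<^sup>2"
      by (intro tendsto_power tendsto_norm tendsto_diff tendsto_add tendsto_const lim)
    have D2: "D \<le> (norm (x - (y0 + c *\<^sub>C e)))\<^sup>2"
      by (rule LIMSEQ_le_const[OF lim2]) (use D_le[OF mem] in blast)
    have "complex_of_real ((norm (x - (y0 + c *\<^sub>C e)))\<^sup>2) = of_real ((norm z)\<^sup>2 - (cmod c)\<^sup>2 * (norm e)\<^sup>2)"
    proof -
      have eq: "x - (y0 + c *\<^sub>C e) = z - c *\<^sub>C e" by (simp add: z_def)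
      have ce: "cinner e z = c * of_real ((norm e)\<^sup>2)" using n0 by (simp add: c_def)
      have cz: "cinner z e = cnj c * of_real ((norm e)\<^sup>2)"
        by (subst cinner_commute) (simp add: ce)
      have "cinner (z - c *\<^sub>C e) (z - c *\<^sub>C e)
          = of_real ((norm z)\<^sup>2) - (c * cnj c) * of_real ((norm e)\<^sup>2)"
        by (simp add: cinner_diff_left cinner_diff_right cinner_scaleC_left cinner_scaleC_right
            ce cz cinner_self[of z] cinner_self[of e] algebra_simps del: of_real_power)
      then show ?thesis unfolding eq cinner_self complex_norm_square[symmetric] by simp
    qed
    then have "(norm (x - (y0 + c *\<^sub>C e)))\<^sup>2 = (norm z)\<^sup>2 - (cmod c)\<^sup>2 * (norm e)\<^sup>2"
      by (simp only: of_real_eq_iff)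
    then have "(cmod c)\<^sup>2 * (norm e)\<^sup>2 \<le> 0" using zD D2 by simp
    then have "c = 0" using False by (simp add: mult_le_0_iff)
    then show ?thesis using False by (simp add: c_def)
  qed auto
  show ?thesis by (rule that[OF z0 orth])
qed

text \<open>Zorn's lemma gives a maximal orthonormal set. Were its span not dense, a normalised
  vector orthogonal to the span could be added to it.\<close>

lemma onb_extension:
  fixes B :: "'a::chilbert_space set"
  assumes "orthonormal B"
  obtains E where "is_onb E" "B \<subseteq> E"
proof -
  let ?A = "{E. orthonormal E \<and> B \<subseteq> E}"
  have "\<exists>E\<in>?A. \<forall>X\<in>?A. E \<subseteq> X \<longrightarrow> X = E"
  proof (rule subset_Zorn_nonempty)
    show "?A \<noteq> {}" using assms by blast
    fix C assume C: "C \<noteq> {}" "subset.chain ?A C"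
    have "orthonormal (\<Union>C)"
      unfolding orthonormal_def
    proof (intro ballI)
      fix e f assume "e \<in> \<Union>C" "f \<in> \<Union>C"
      then obtain X Y where XY: "X \<in> C" "Y \<in> C" "e \<in> X" "f \<in> Y" by blast
      then have "X \<subseteq> Y \<or> Y \<subseteq> X" using C(2) by (auto simp: subset_chain_def)
      then obtain Z where "Z \<in> C" "e \<in> Z" "f \<in> Z" using XY by blast
      moreover have "orthonormal Z" using C(2) \<open>Z \<in> C\<close> by (auto simp: subset_chain_def)
      ultimately show "cinner e f = (if e = f then 1 else 0)" by (auto simp: orthonormal_def)
    qed
    moreover obtain X where "X \<in> C" using C(1) by blast
    then have "B \<subseteq> \<Union>C" using C(2) by (auto simp: subset_chain_def)
    ultimately show "\<Union>C \<in> ?A" by simp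
  qed
  then obtain E where "E \<in> ?A" and maxE: "\<forall>X\<in>?A. E \<subseteq> X \<longrightarrow> X = E" ..
  then have E: "orthonormal E" "B \<subseteq> E" by simp_all
  have "x \<in> closure (cvec.span E)" for x
  proof (rule ccontr)
    assume "x \<notin> closure (cvec.span E)"
    then obtain z where z: "z \<noteq> 0" "\<And>e. e \<in> E \<Longrightarrow> cinner e z = 0"
      using nearest_point_orthogonal by blast
    have s1: "cinner (sgn z) (sgn z) = 1" using z(1) by (simp add: cinner_self norm_sgn)
    have s2: "cinner e (sgn z) = 0" if "e \<in> E" for e
      using z(2)[OF that] by (simp add: sgn_div_norm cinner_scaleR_right)
    then have s3: "cinner (sgn z) e = 0" if "e \<in> E" for e
      by (subst cinner_commute) (simp add: that)
    have notin: "sgn z \<notin> E" using s1 s2 by force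
    have "orthonormal (insert (sgn z) E)"
      using E(1) s1 s2 s3 notin by (auto simp: orthonormal_def)
    then have "insert (sgn z) E = E" using E(2) by (intro maxE[rule_format]) auto
    then show False using notin by blast
  qed
  then have "is_onb E" using E(1) by (auto simp: is_onb_def orthonormal_def)
  then show ?thesis using E(2) that by blast
qed

section \<open>Expansion in an orthonormal basis and Parseval's identity\<close>

lemma orthonormal_best_approx:
  assumes E: "orthonormal F" and fin: "finite F" and y: "y \<in> cvec.span F"
  shows "norm (x - (\<Sum>e\<in>F. cinner e x *\<^sub>C e)) \<le> norm (x - y)"
proof -
  define P where "P = (\<Sum>e\<in>F. cinner e x *\<^sub>C e)"
  have orth: "cinner f (x - P) = 0" if f: "f \<in> F" for f
  proof -
    have "cinner f P = (\<Sum>e\<in>F. if e = f then cinner f x else 0)"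
      unfolding P_def cinner_sum_right cinner_scaleC_right
      by (rule sum.cong) (use E f in \<open>auto simp: orthonormal_def\<close>)
    then show ?thesis using fin f by (simp add: cinner_diff_right)
  qed
  have "P - y \<in> cvec.span F"
    unfolding P_def
    by (intro cvec.span_diff cvec.span_sum cvec.span_scale cvec.span_base y)
  \<comment> \<open>The residual \<open>x - P\<close> is orthogonal to all of the span, so
    Pythagoras applies to \<open>x - y\<close>, the sum of \<open>x - P\<close> and
    \<open>P - y\<close>.\<close>
  then have "cinner (P - y) (x - P) = 0"
  proof (induction rule: cvec.span_induct_alt)
    case (step c v w) then show ?case
      by (simp add: cinner_add_left cinner_scaleC_left orth)
  qed simp
  then have "inner (P - y) (x - P) = 0" by (metis Re_cinner zero_complex.simps(1))
  then have "(norm (x - P + (P - y)))\<^sup>2 = (norm (x - P))\<^sup>2 + (norm (P - y))\<^sup>2"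
    unfolding power2_norm_eq_inner by (simp only: inner_add_left inner_add_right inner_commute[of "x - P" "P - y"])
  then have "(norm (x - P))\<^sup>2 \<le> (norm (x - y))\<^sup>2" by simp
  then show ?thesis unfolding P_def by (rule power2_le_imp_le) simp
qed

text \<open>A vector of the span close to \<open>x\<close> involves only a finite set
  \<open>t\<close> of basis vectors. By best approximation, every finite partial sum over a superset
  of \<open>t\<close> is at least as close to \<open>x\<close>.\<close>

lemma onb_expansion:
  assumes E: "is_onb E"
  shows "((\<lambda>e. cinner e x *\<^sub>C e) has_sum x) E"
  unfolding has_sum_def
proof (rule tendstoI)
  fix \<epsilon> :: real assume "\<epsilon> > 0"
  moreover have "x \<in> closure (cvec.span E)" using E by (simp add: is_onb_def)
  ultimately obtain y where y: "y \<in> cvec.span E" "dist y x < \<epsilon>"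
    by (meson closure_approachable)
  obtain t r where t: "finite t" "t \<subseteq> E" "y = (\<Sum>a\<in>t. r a *\<^sub>C a)"
    using y(1) unfolding cvec.span_explicit by blast
  show "\<forall>\<^sub>F F in finite_subsets_at_top E. dist (\<Sum>e\<in>F. cinner e x *\<^sub>C e) x < \<epsilon>"
    unfolding eventually_finite_subsets_at_top
  proof (intro exI[of _ t] conjI allI impI t(1,2))
    fix F assume F: "finite F \<and> t \<subseteq> F \<and> F \<subseteq> E"
    have "y \<in> cvec.span F"
      unfolding t(3) using F by (intro cvec.span_sum cvec.span_scale cvec.span_base) blast
    moreover have "orthonormal F"
      using F orthonormal_mono[OF onb_orthonormal[OF E]] by blast
    ultimately have "norm (x - (\<Sum>e\<in>F. cinner e x *\<^sub>C e)) \<le> norm (x - y)"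
      using F by (intro orthonormal_best_approx) auto
    then show "dist (\<Sum>e\<in>F. cinner e x *\<^sub>C e) x < \<epsilon>"
      using y(2) by (simp add: dist_norm norm_minus_commute)
  qed
qed

lemma onb_parseval:
  assumes "is_onb E"
  shows "((\<lambda>e. cinner e x * cinner y e) has_sum cinner y x) E"
  using has_sum_bounded_linear[OF bounded_linear_cinner_right onb_expansion[OF assms], of y x]
  by (simp add: o_def cinner_scaleC_right)

section \<open>Squash operators from Kraus families\<close>

lemma bounded_clinear_add: "bounded_clinear T \<Longrightarrow> T (x + y) = T x + T y"
  by (simp add: bounded_clinear_def linear_simps)

lemma bounded_clinear_diff: "bounded_clinear T \<Longrightarrow> T (x - y) = T x - T y"
  by (simp add: bounded_clinear_def linear_simps)

lemma bounded_clinear_scaleC: "bounded_clinear T \<Longrightarrow> T (c *\<^sub>C x) = c *\<^sub>C T x"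
  by (simp add: bounded_clinear_def)

lemma bounded_clinear_scaleR: "bounded_clinear T \<Longrightarrow> T (c *\<^sub>R x) = c *\<^sub>R T x"
  by (simp add: bounded_clinear_def linear_simps)

lemma bounded_clinear_zero: "bounded_clinear T \<Longrightarrow> T 0 = 0"
  by (simp add: bounded_clinear_def linear_simps)

lemma bounded_clinear_sum: "bounded_clinear T \<Longrightarrow> T (sum f A) = (\<Sum>i\<in>A. T (f i))"
  unfolding bounded_clinear_def by (metis bounded_linear.linear linear_sum)

lemma sum_nonneg_Reals:
  "(\<And>i. i \<in> A \<Longrightarrow> f i \<in> \<real>\<^sub>\<ge>\<^sub>0) \<Longrightarrow> sum f A \<in> (\<real>\<^sub>\<ge>\<^sub>0 :: complex set)"
  by (induction A rule: infinite_finite_induct) auto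

text \<open>Serves to show that the weight left over by the Kraus operators is nonnegative. For
  finite \<open>F\<close> containing \<open>B\<close> the difference is the sum over
  \<open>F - B\<close> plus \<open>1 - l\<close> times the sum over \<open>B\<close>; the limit
  stays in a closed set.\<close>

lemma has_sum_remainder_nonneg:
  fixes f :: "'b \<Rightarrow> complex"
  assumes f: "(f has_sum s) E" "\<And>x. x \<in> E \<Longrightarrow> f x \<in> \<real>\<^sub>\<ge>\<^sub>0"
    and B: "finite B" "B \<subseteq> E" and l: "0 \<le> l" "l \<le> 1"
  shows "s - of_real l * sum f B \<in> \<real>\<^sub>\<ge>\<^sub>0"
proof (rule Lim_in_closed_set[OF closed_nonneg_Reals_complex])
  show "((\<lambda>F. sum f F - of_real l * sum f B) \<longlongrightarrow> s - of_real l * sum f B)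
      (finite_subsets_at_top E)"
    using f(1) unfolding has_sum_def by (intro tendsto_diff tendsto_const)
  have "sum f F - of_real l * sum f B \<in> \<real>\<^sub>\<ge>\<^sub>0" if F: "finite F" "B \<subseteq> F" "F \<subseteq> E" for F
  proof -
    have "sum f F - of_real l * sum f B = sum f (F - B) + of_real (1 - l) * sum f B"
      using sum.subset_diff[OF F(2,1), of f] by (simp add: algebra_simps)
    also have "\<dots> \<in> \<real>\<^sub>\<ge>\<^sub>0"
      using F l B f(2)
      by (intro nonneg_Reals_add_I nonneg_Reals_mult_I sum_nonneg_Reals) (auto simp: subset_eq complex_nonneg_Reals_iff)
    finally show ?thesis .
  qed
  then show "\<forall>\<^sub>F F in finite_subsets_at_top E. sum f F - of_real l * sum f B \<in> \<real>\<^sub>\<ge>\<^sub>0"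
    unfolding eventually_finite_subsets_at_top using B by blast
qed simp

lemma has_sum_sum:
  assumes "\<And>i. i \<in> I \<Longrightarrow> ((f i) has_sum (s i :: complex)) A"
  shows "((\<lambda>x. \<Sum>i\<in>I. f i x) has_sum (\<Sum>i\<in>I. s i)) A"
  using assms by (induction I rule: infinite_finite_induct) (auto intro: has_sum_add)

text \<open>
  The Kraus operators \<open>F\<^sub>c\<close> enter through the images \<open>\<psi> c k\<close> of the standard basis under
  \<open>F\<^sub>c\<^sup>\<dagger>\<close>. They need not resolve the identity: \<open>wt\<close> says that the sum of the \<open>F\<^sub>c\<^sup>\<dagger> F\<^sub>c\<close> is \<open>l\<close>
  times a finite-rank projection, and the remaining weight is sent to the maximally mixed qubit,
  which the Pauli matrices do not see.
\<close>

lemma squash_operator_from_kraus: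
  fixes \<psi> :: "'i::finite \<Rightarrow> 2 \<Rightarrow> 'a::chilbert_space" and e :: "'j::finite \<Rightarrow> 'a" and l :: real
  assumes orth: "\<And>i j. i \<noteq> j \<Longrightarrow> cinner (e i) (e j) = 0"
    and norm01: "\<And>i. e i = 0 \<or> norm (e i) = 1"
    and l: "0 \<le> l" "l \<le> 1"
    and wt: "\<And>T. bounded_clinear T \<Longrightarrow>
      (\<Sum>c\<in>UNIV. \<Sum>k\<in>UNIV. cinner (\<psi> c k) (T (\<psi> c k)))
        = of_real l * (\<Sum>j\<in>UNIV. cinner (e j) (T (e j)))"
    and obs: "\<And>r z. observable M r z =
      (\<Sum>c\<in>UNIV. \<Sum>k\<in>UNIV. \<Sum>m\<in>UNIV. (pauli r $ m $ k * cinner (\<psi> c k) z) *\<^sub>C \<psi> c m)"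
  shows "\<exists>F. squash_operator M F"
proof -
  \<comment> \<open>Zero vectors are discarded, so that \<open>B\<close> is orthonormal and extends
    to a basis \<open>E\<close>. Trace and Kraus weight are then compared term by term in the same
    basis.\<close>
  define B where "B = range e - {0}"
  have finB: "finite B" by (simp add: B_def)
  have "orthonormal B"
    unfolding orthonormal_def B_def
  proof (intro ballI)
    fix v w assume "v \<in> range e - {0}" "w \<in> range e - {0}"
    then obtain i j where ij: "v = e i" "w = e j" "e i \<noteq> 0" "e j \<noteq> 0" by blast
    show "cinner v w = (if v = w then 1 else 0)"
    proof (cases "i = j")
      case True
      then show ?thesis using ij norm01[of i] by (simp add: cinner_self)
    next
      case False
      have "e i \<noteq> e j" using orth[OF False] ij by auto
      then show ?thesis using ij orth[OF False] by simp
    qed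
  qed
  then obtain E where E: "is_onb E" "B \<subseteq> E" by (rule onb_extension)
  have sum_e: "(\<Sum>j\<in>UNIV. cinner (e j) (T (e j))) = (\<Sum>v\<in>B. cinner v (T v))" for T
  proof -
    have "(\<Sum>v\<in>B. cinner v (T v)) = (\<Sum>v\<in>range e. cinner v (T v))"
      unfolding B_def by (rule sum.mono_neutral_left) auto
    also have "\<dots> = (\<Sum>j\<in>UNIV. cinner (e j) (T (e j)))"
    proof (rule sum.reindex_nontrivial[unfolded o_def])
      fix i j assume "i \<noteq> j" "e i = e j"
      then have "e i = 0" using orth[of i j] by simp
      then show "cinner (e i) (T (e i)) = 0" by simp
    qed simp
    finally show ?thesis ..
  qed
  \<comment> \<open>The trace is computed in the fixed basis \<open>E\<close>. For trace class
    operators this agrees with every other basis; elsewhere the value is irrelevant.\<close>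
  define tr where "tr T = infsum (\<lambda>v. cinner v (T v)) E" for T
  have tr: "((\<lambda>v. cinner v (T v)) has_sum tr T) E" "t = tr T" if "has_op_trace T t" for T t
    using that E(1) unfolding has_op_trace_def tr_def by (auto simp: infsumI)
  have tr_class: "bounded_clinear T" "has_op_trace T (tr T)" if "trace_class_op T" for T
    using that tr(2) unfolding trace_class_op_def by blast+
  \<comment> \<open>\<open>K T\<close> is the trace carried by the Kraus operators. The deficit
    \<open>tr T - K T\<close> is split evenly over the diagonal of \<open>F T\<close>.\<close>
  define K where "K T = (\<Sum>c\<in>UNIV. \<Sum>k\<in>UNIV. cinner (\<psi> c k) (T (\<psi> c k)))" for T
  define F where "F T = (\<chi> k m. (\<Sum>c\<in>UNIV. cinner (\<psi> c k) (T (\<psi> c m)))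
      + (if k = m then (tr T - K T) / 2 else 0))" for T
  have tr_add: "tr (\<lambda>x. S x + T x) = tr S + tr T" if "trace_class_op S" "trace_class_op T" for S T
    unfolding tr_def cinner_add_right
    by (rule infsumI, rule has_sum_add; fold tr_def; rule tr(1)[OF tr_class(2)]) (use that in auto)
  have tr_scale: "tr (\<lambda>x. c *\<^sub>C T x) = c * tr T" if "trace_class_op T" for c T
    unfolding tr_def cinner_scaleC_right
    by (rule infsumI, rule has_sum_cmult_right, fold tr_def, rule tr(1)[OF tr_class(2)[OF that]])
  have K_add: "K (\<lambda>x. S x + T x) = K S + K T" for S T
    by (simp add: K_def cinner_add_right sum.distrib)
  have K_scale: "K (\<lambda>x. c *\<^sub>C T x) = c * K T" for c T
    by (simp add: K_def cinner_scaleC_right sum_distrib_left)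
  have "clinear_on_trace_class F"
    unfolding clinear_on_trace_class_def
  proof (intro conjI allI impI)
    fix S T :: "'a \<Rightarrow> 'a" assume "trace_class_op S \<and> trace_class_op T"
    then show "F (\<lambda>x. S x + T x) = F S + F T"
      by (simp add: F_def vec_eq_iff cinner_add_right sum.distrib tr_add K_add add_divide_distrib diff_divide_distrib)
  next
    fix c and T :: "'a \<Rightarrow> 'a" assume "trace_class_op T"
    then show "F (\<lambda>x. c *\<^sub>C T x) = c *\<^sub>C F T"
      by (simp add: F_def vec_eq_iff scaleC_vec_def scaleC_complex_def cinner_scaleC_right
          sum_distrib_left tr_scale K_scale algebra_simps)
  qed
  moreover have "completely_positive F"
    unfolding completely_positive_def
  proof (intro allI impI)
    fix n and T :: "nat \<Rightarrow> nat \<Rightarrow> 'a \<Rightarrow> 'a"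
    assume T: "(\<forall>i<n. \<forall>j<n. trace_class_op (T i j)) \<and> block_positive n T"
    then have lin: "bounded_clinear (T i j)" and trT: "((\<lambda>v. cinner v (T i j v)) has_sum tr (T i j)) E"
      if "i < n" "j < n" for i j
      using that tr_class tr(1) by blast+
    have pos: "(\<Sum>i<n. \<Sum>j<n. cinner (x i) (T i j (x j))) \<in> \<real>\<^sub>\<ge>\<^sub>0" for x
      using T by (simp add: block_positive_def)
    show "block_positive n (\<lambda>i j v. F (T i j) *v v)"
      unfolding block_positive_def
    proof
      fix x :: "nat \<Rightarrow> complex ^ 2"
      \<comment> \<open>\<open>\<phi> c i\<close> is the image of \<open>x i\<close> under the
        adjoint of the Kraus operator \<open>c\<close>, so the Kraus part of each block is a value
        of the form given by \<open>T\<close>.\<close>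
      define \<phi> where "\<phi> c i = (\<Sum>m\<in>UNIV. x i $ m *\<^sub>C \<psi> c m)" for c i
      have block: "cinner (x i) (F (T i j) *v x j) = (\<Sum>c\<in>UNIV. cinner (\<phi> c i) (T i j (\<phi> c j)))
          + (\<Sum>k\<in>UNIV. cnj (x i $ k) * x j $ k * (tr (T i j) - K (T i j))) / 2"
        if ij: "i < n" "j < n" for i j
      proof -
        have 1: "(\<Sum>c\<in>UNIV. cinner (\<phi> c i) (T i j (\<phi> c j)))
            = (\<Sum>k\<in>UNIV. \<Sum>m\<in>UNIV. cnj (x i $ k) * (\<Sum>c\<in>UNIV. cinner (\<psi> c k) (T i j (\<psi> c m))) * x j $ m)"
          unfolding \<phi>_def bounded_clinear_sum[OF lin[OF ij]] bounded_clinear_scaleC[OF lin[OF ij]]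
          by (simp add: sum_2 cinner_add_left cinner_add_right cinner_scaleC_left
              cinner_scaleC_right sum.distrib sum_distrib_left sum_distrib_right algebra_simps)
        show ?thesis unfolding 1
          by (simp add: F_def cinner_vec_def cinner_complex_def matrix_vector_mult_def sum_2
              algebra_simps add_divide_distrib diff_divide_distrib)
      qed
      have rest: "(\<Sum>i<n. \<Sum>j<n. cnj (x i $ k) * x j $ k * (tr (T i j) - K (T i j))) \<in> \<real>\<^sub>\<ge>\<^sub>0" for k
      proof -
        \<comment> \<open>\<open>G v\<close> is the block form of \<open>T\<close> at the vectors
          \<open>x i $ k *\<^sub>C v\<close>, hence nonnegative. Its sum over \<open>E\<close>
          yields the traces, and \<open>l\<close> times its sum over \<open>B\<close> yields the
          values of \<open>K\<close>.\<close>
        define G where "G v = (\<Sum>i<n. \<Sum>j<n. cnj (x i $ k) * x j $ k * cinner v (T i j v))" for v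
        have "(G has_sum (\<Sum>i<n. \<Sum>j<n. cnj (x i $ k) * x j $ k * tr (T i j))) E"
          unfolding G_def by (intro has_sum_sum has_sum_cmult_right trT) auto
        moreover have "G v \<in> \<real>\<^sub>\<ge>\<^sub>0" for v
        proof -
          have "G v = (\<Sum>i<n. \<Sum>j<n. cinner (x i $ k *\<^sub>C v) (T i j (x j $ k *\<^sub>C v)))"
            unfolding G_def by (intro sum.cong refl)
              (simp add: bounded_clinear_scaleC[OF lin] cinner_scaleC_left cinner_scaleC_right)
          then show ?thesis using pos by simp
        qed
        ultimately have "(\<Sum>i<n. \<Sum>j<n. cnj (x i $ k) * x j $ k * tr (T i j))
            - of_real l * sum G B \<in> \<real>\<^sub>\<ge>\<^sub>0"
          by (rule has_sum_remainder_nonneg[OF _ _ finB E(2) l])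
        moreover have "of_real l * sum G B = (\<Sum>i<n. \<Sum>j<n. cnj (x i $ k) * x j $ k * K (T i j))"
        proof -
          have "sum G B = (\<Sum>i<n. \<Sum>j<n. \<Sum>v\<in>B. cnj (x i $ k) * x j $ k * cinner v (T i j v))"
            unfolding G_def by (subst sum.swap, intro sum.cong refl, rule sum.swap)
          then have "of_real l * sum G B = (\<Sum>i<n. \<Sum>j<n. cnj (x i $ k) * x j $ k
              * (of_real l * (\<Sum>v\<in>B. cinner v (T i j v))))"
            by (simp add: sum_distrib_left mult_ac)
          also have "\<dots> = (\<Sum>i<n. \<Sum>j<n. cnj (x i $ k) * x j $ k * K (T i j))"
            by (intro sum.cong refl) (simp add: K_def wt[OF lin] sum_e)
          finally show ?thesis .
        qed
        ultimately show ?thesis by (simp add: right_diff_distrib sum_subtractf)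
      qed
      have "(\<Sum>i<n. \<Sum>j<n. cinner (x i) (F (T i j) *v x j)) =
          (\<Sum>c\<in>UNIV. \<Sum>i<n. \<Sum>j<n. cinner (\<phi> c i) (T i j (\<phi> c j)))
          + (\<Sum>k\<in>UNIV. \<Sum>i<n. \<Sum>j<n. cnj (x i $ k) * x j $ k * (tr (T i j) - K (T i j))) * (1/2)"
      proof -
        have "(\<Sum>i<n. \<Sum>j<n. cinner (x i) (F (T i j) *v x j)) =
          (\<Sum>i<n. \<Sum>j<n. \<Sum>c\<in>UNIV. cinner (\<phi> c i) (T i j (\<phi> c j)))
          + (\<Sum>i<n. \<Sum>j<n. \<Sum>k\<in>UNIV. cnj (x i $ k) * x j $ k * (tr (T i j) - K (T i j))) / 2"
          by (simp add: block sum.distrib sum_divide_distrib)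
        also have "(\<Sum>i<n. \<Sum>j<n. \<Sum>c\<in>UNIV. cinner (\<phi> c i) (T i j (\<phi> c j)))
            = (\<Sum>c\<in>UNIV. \<Sum>i<n. \<Sum>j<n. cinner (\<phi> c i) (T i j (\<phi> c j)))"
          by (subst sum.swap[of _ _ UNIV], intro sum.cong refl, rule sum.swap)
        also have "(\<Sum>i<n. \<Sum>j<n. \<Sum>k\<in>UNIV. cnj (x i $ k) * x j $ k * (tr (T i j) - K (T i j)))
            = (\<Sum>k\<in>UNIV. \<Sum>i<n. \<Sum>j<n. cnj (x i $ k) * x j $ k * (tr (T i j) - K (T i j)))"
          by (subst sum.swap[of _ _ UNIV], intro sum.cong refl, rule sum.swap)
        finally show ?thesis by simp
      qed
      also have "\<dots> \<in> \<real>\<^sub>\<ge>\<^sub>0"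
        by (intro nonneg_Reals_add_I nonneg_Reals_mult_I sum_nonneg_Reals pos rest)
          (simp add: complex_nonneg_Reals_iff)
      finally show "(\<Sum>i<n. \<Sum>j<n. cinner (x i) (F (T i j) *v x j)) \<in> \<real>\<^sub>\<ge>\<^sub>0" .
    qed
  qed
  moreover have "trace_preserving F"
    unfolding trace_preserving_def
  proof (intro allI impI)
    fix T :: "'a \<Rightarrow> 'a" assume "trace_class_op T"
    moreover have "trace (F T) = tr T"
      by (simp add: trace_def F_def K_def sum_2 sum.distrib field_simps)
    ultimately show "has_op_trace T (trace (F T))" using tr_class(2) by simp
  qed
  moreover have "has_op_trace (\<rho> \<circ> observable M r) (trace (F \<rho> ** pauli r))" if "density_op \<rho>" for \<rho> r
  proof -
    have lin: "bounded_clinear \<rho>" using that by (simp add: density_op_def positive_op_def)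
    \<comment> \<open>The multiple of the identity in \<open>F \<rho>\<close> drops out because the
      Pauli matrices have trace zero.\<close>
    have "trace (F \<rho> ** pauli r) = (\<Sum>c\<in>UNIV. \<Sum>k\<in>UNIV. \<Sum>m\<in>UNIV.
        pauli r $ m $ k * cinner (\<psi> c k) (\<rho> (\<psi> c m)))"
      by (cases r) (simp_all add: trace_def F_def matrix_matrix_mult_def sum_2 sum.distrib
          sum_subtractf sum_negf)
    moreover have "((\<lambda>v. cinner v ((\<rho> \<circ> observable M r) v)) has_sum
        (\<Sum>c\<in>UNIV. \<Sum>k\<in>UNIV. \<Sum>m\<in>UNIV. pauli r $ m $ k * cinner (\<psi> c k) (\<rho> (\<psi> c m)))) E'"
      if "is_onb E'" for E'
    proof -
      \<comment> \<open>By \<open>obs\<close> the operator is a finite sum of rank-one operators,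
        and Parseval evaluates the trace of each of them in any basis.\<close>
      have "cinner v ((\<rho> \<circ> observable M r) v) = (\<Sum>c\<in>UNIV. \<Sum>k\<in>UNIV. \<Sum>m\<in>UNIV.
          pauli r $ m $ k * (cinner v (\<rho> (\<psi> c m)) * cinner (\<psi> c k) v))" for v
        by (simp add: obs bounded_clinear_sum[OF lin] bounded_clinear_scaleC[OF lin]
            cinner_sum_right cinner_scaleC_right mult_ac)
      then show ?thesis
        by (simp only:) (intro has_sum_sum has_sum_cmult_right onb_parseval that)
    qed
    ultimately show ?thesis unfolding has_op_trace_def by simp
  qed
  ultimately show ?thesis unfolding squash_operator_def cptp_def by blast
qed

section \<open>Squashing onto a four-cycle of orthogonal vectors\<close>

abbreviation bsign :: "bool \<Rightarrow> complex"
  where "bsign s \<equiv> (if s then 1 else - 1)"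

lemma sum_UNIV_pair:
  fixes f :: "'b::finite \<times> 'c::finite \<Rightarrow> 'd::comm_monoid_add"
  shows "(\<Sum>c\<in>UNIV. f c) = (\<Sum>s\<in>UNIV. \<Sum>t\<in>UNIV. f (s, t))"
  by (simp add: sum.cartesian_product flip: UNIV_Times_UNIV)

text \<open>
  The vectors form the cycle \<open>a True \<rightarrow> b True \<rightarrow> a False \<rightarrow> b False \<rightarrow> a True\<close>. Up to the factor
  \<open>l\<close>, half of \<open>M\<^sub>z + \<i> M\<^sub>x\<close> is the sum of the rank-one operators along its edges, while half of
  \<open>\<sigma>\<^sub>z + \<i> \<sigma>\<^sub>x\<close> is a single rank-one operator, so that each edge contributes one Kraus operator.
  An edge weighs its endpoint \<open>a s\<close> by \<open>l * (norm (b t))\<^sup>2\<close> and conversely, so that every vertex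
  receives the total weight \<open>l\<close>.
\<close>

lemma squash_operator_four_cycle:
  fixes a b :: "bool \<Rightarrow> 'a::chilbert_space" and l :: real
  assumes orth_a: "cinner (a True) (a False) = 0"
    and orth_b: "cinner (b True) (b False) = 0"
    and orth_ab: "\<And>s t. cinner (a s) (b t) = 0"
    and norm_a: "(\<Sum>s\<in>UNIV. (norm (a s))\<^sup>2) = 1"
    and norm_b: "(\<Sum>t\<in>UNIV. (norm (b t))\<^sup>2) = 1"
    and l: "0 \<le> l" "l \<le> 1"
    and obs_z: "\<And>z. observable M z_basis z = (\<Sum>s\<in>UNIV. \<Sum>t\<in>UNIV.
      of_real l *\<^sub>C (cinner (b t) z *\<^sub>C a s + cinner (a s) z *\<^sub>C b t))"
    and obs_x: "\<And>z. observable M x_basis z = (\<Sum>s\<in>UNIV. \<Sum>t\<in>UNIV.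
      (of_real l * \<i> * bsign s * bsign t) *\<^sub>C (cinner (a s) z *\<^sub>C b t - cinner (b t) z *\<^sub>C a s))"
  shows "\<exists>F. squash_operator M F"
proof -
  \<comment> \<open>The scalings make the rank-one operator formed from \<open>x (s, t)\<close> and
    \<open>y (s, t)\<close> equal to \<open>l\<close> times the one formed from \<open>a s\<close>
    and \<open>b t\<close>, while giving the endpoints their required weights. As
    \<open>sgn 0 = 0\<close>, vanishing vertices cause no exception.\<close>
  define x where "x = (\<lambda>(s, t). (sqrt l * norm (b t)) *\<^sub>R sgn (a s))"
  define y where "y = (\<lambda>(s, t). (sqrt l * norm (a s)) *\<^sub>R sgn (b t))"
  define h where "h = complex_of_real (1 / sqrt 2)"
  \<comment> \<open>\<open>g\<close> is \<open>1\<close> on the edges of the cycle that leave some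
    \<open>a s\<close> and \<open>- 1\<close> on those that leave some \<open>b t\<close>.\<close>
  define g where "g c = bsign (fst c) * bsign (snd c)" for c
  \<comment> \<open>The phase of \<open>d c\<close> is invisible to the \<sigma>_z term and to the
    weights. It turns the \<sigma>_x term into the antisymmetric combination with the sign of the
    edge.\<close>
  define d where "d c = h * (- \<i> * g c)" for c
  define \<psi> :: "bool \<times> bool \<Rightarrow> 2 \<Rightarrow> 'a" where "\<psi> = (\<lambda>c k.
    if k = 1 then h *\<^sub>C (x c + y c) else d c *\<^sub>C (x c - y c))"
  define e where "e = (\<lambda>(d, s). sgn (if d then a s else b s))"
  have h: "h * h = 1 / 2" "cnj h = h"
    unfolding h_def by (simp_all flip: of_real_mult)
  have g: "g c * g c = 1" "cnj (g c) = g c" for c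
    by (auto simp: g_def)
  have hd: "cnj h * h = 1 / 2" "cnj (d c) * d c = 1 / 2"
    "cnj (d c) * h = \<i> * g c / 2" "cnj h * d c = - (\<i> * g c / 2)" for c
  proof -
    show "cnj h * h = 1 / 2" unfolding h(2) by (rule h(1))
    have "cnj (d c) * d c = (h * h) * (g c * g c)" "cnj (d c) * h = (h * h) * (\<i> * g c)"
      "cnj h * d c = - ((h * h) * (\<i> * g c))"
      by (simp_all only: d_def complex_cnj_mult complex_cnj_minus complex_cnj_i h(2) g(2))
        (simp_all add: algebra_simps)
    then show "cnj (d c) * d c = 1 / 2" "cnj (d c) * h = \<i> * g c / 2"
      "cnj h * d c = - (\<i> * g c / 2)"
      unfolding h g by simp_all
  qed
  have \<psi>1: "\<psi> c 1 = h *\<^sub>C (x c + y c)"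
    and \<psi>2: "\<psi> c 2 = d c *\<^sub>C (x c - y c)" for c
    by (simp_all add: \<psi>_def)
  have sql: "complex_of_real (sqrt l) * complex_of_real (sqrt l) = of_real l"
    using l by (simp flip: of_real_mult)
  have nsgn: "norm v *\<^sub>R sgn v = v" for v :: 'a
    by (cases "v = 0") (simp_all add: sgn_div_norm)
  have orth_ba: "cinner (b t) (a s) = 0" for s t
    using orth_ab[of s t] by (subst cinner_commute) simp
  have orth_a': "cinner (a s) (a s') = 0" if "s \<noteq> s'" for s s'
    using that orth_a cinner_commute[of "a False" "a True"] by (cases s; cases s') auto
  have orth_b': "cinner (b s) (b s') = 0" if "s \<noteq> s'" for s s'
    using that orth_b cinner_commute[of "b False" "b True"] by (cases s; cases s') auto
  have orth: "cinner (e i) (e j) = 0" if "i \<noteq> j" for i j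
    using that orth_ab orth_ba orth_a' orth_b'
    by (cases i; cases j) (auto simp: e_def sgn_div_norm cinner_scaleR_left cinner_scaleR_right)
  have norm01: "e i = 0 \<or> norm (e i) = 1" for i
    by (cases i) (auto simp: e_def norm_sgn sgn_zero_iff)
  have rank1: "cinner (x (s,t)) z *\<^sub>C y (s,t) = of_real l *\<^sub>C (cinner (a s) z *\<^sub>C b t)"
    "cinner (y (s,t)) z *\<^sub>C x (s,t) = of_real l *\<^sub>C (cinner (b t) z *\<^sub>C a s)" for s t z
  proof -
    have *: "cinner ((sqrt l * norm w) *\<^sub>R sgn v) z *\<^sub>C ((sqrt l * norm v) *\<^sub>R sgn w)
        = of_real l *\<^sub>C (cinner v z *\<^sub>C w)" for v w :: 'a
    proof -
      have "cinner ((sqrt l * norm w) *\<^sub>R sgn v) z *\<^sub>C ((sqrt l * norm v) *\<^sub>R sgn w)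
        = (of_real (sqrt l) * of_real (sqrt l)) *\<^sub>C (cinner (norm v *\<^sub>R sgn v) z *\<^sub>C (norm w *\<^sub>R sgn w))"
        by (simp add: cinner_scaleC_left scaleC_of_real[symmetric] scaleC_scaleC mult_ac)
      then show ?thesis by (simp only: nsgn sql)
    qed
    show "cinner (x (s,t)) z *\<^sub>C y (s,t) = of_real l *\<^sub>C (cinner (a s) z *\<^sub>C b t)"
      "cinner (y (s,t)) z *\<^sub>C x (s,t) = of_real l *\<^sub>C (cinner (b t) z *\<^sub>C a s)"
      unfolding x_def y_def by (simp_all add: *)
  qed
  show ?thesis
  proof (rule squash_operator_from_kraus[of e l \<psi>])
    show "cinner (e i) (e j) = 0" if "i \<noteq> j" for i j by (rule orth[OF that])
    show "e i = 0 \<or> norm (e i) = 1" for i by (rule norm01)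
    show "0 \<le> l" "l \<le> 1" by (rule l)+
  next
    fix T :: "'a \<Rightarrow> 'a" assume T: "bounded_clinear T"
    \<comment> \<open>Both coefficients have squared modulus \<open>1 / 2\<close>, so the cross
      terms of \<open>x c + y c\<close> and \<open>x c - y c\<close> cancel.\<close>
    have "(\<Sum>k\<in>UNIV. cinner (\<psi> c k) (T (\<psi> c k))) = cinner (x c) (T (x c)) + cinner (y c) (T (y c))" for c
    proof -
      have scale: "cinner (u *\<^sub>C v) (T (u *\<^sub>C v)) = (cnj u * u) * cinner v (T v)" for u v
        by (simp add: bounded_clinear_scaleC[OF T] cinner_scaleC_left cinner_scaleC_right)
      show ?thesis
        unfolding sum_2 \<psi>1 \<psi>2 scale hd
        by (simp add: bounded_clinear_add[OF T] bounded_clinear_diff[OF T]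
            cinner_add_left cinner_add_right cinner_diff_left cinner_diff_right field_simps)
    qed
    moreover have "cinner (x (s,t)) (T (x (s,t))) = of_real l * (of_real ((norm (b t))\<^sup>2)
        * cinner (e (True, s)) (T (e (True, s))))"
      "cinner (y (s,t)) (T (y (s,t))) = of_real l * (of_real ((norm (a s))\<^sup>2)
        * cinner (e (False, t)) (T (e (False, t))))" for s t
    proof -
      have *: "cinner ((sqrt l * r) *\<^sub>R v) (T ((sqrt l * r) *\<^sub>R v))
          = of_real l * (of_real (r\<^sup>2) * cinner v (T v))" for r v
      proof -
        have "cinner ((sqrt l * r) *\<^sub>R v) (T ((sqrt l * r) *\<^sub>R v))
          = (of_real (sqrt l) * of_real (sqrt l)) * (of_real (r\<^sup>2) * cinner v (T v))"
          by (simp add: bounded_clinear_scaleR[OF T] cinner_scaleR_left cinner_scaleR_right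
              power2_eq_square mult_ac)
        then show ?thesis by (simp only: sql)
      qed
      show "cinner (x (s,t)) (T (x (s,t))) = of_real l * (of_real ((norm (b t))\<^sup>2)
        * cinner (e (True, s)) (T (e (True, s))))"
       "cinner (y (s,t)) (T (y (s,t))) = of_real l * (of_real ((norm (a s))\<^sup>2)
        * cinner (e (False, t)) (T (e (False, t))))"
        by (simp_all add: x_def y_def e_def *)
    qed
    ultimately have "(\<Sum>c\<in>UNIV. \<Sum>k\<in>UNIV. cinner (\<psi> c k) (T (\<psi> c k)))
      = (\<Sum>s\<in>UNIV. \<Sum>t\<in>UNIV. of_real l * (of_real ((norm (b t))\<^sup>2) * cinner (e (True, s)) (T (e (True, s))))
          + of_real l * (of_real ((norm (a s))\<^sup>2) * cinner (e (False, t)) (T (e (False, t)))))"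
      by (simp only: sum_UNIV_pair)
    also have "\<dots> = of_real l * (of_real (\<Sum>t\<in>UNIV. (norm (b t))\<^sup>2) * (\<Sum>s\<in>UNIV. cinner (e (True, s)) (T (e (True, s))))
        + of_real (\<Sum>s\<in>UNIV. (norm (a s))\<^sup>2) * (\<Sum>t\<in>UNIV. cinner (e (False, t)) (T (e (False, t)))))"
      by (simp add: UNIV_bool algebra_simps)
    also have "\<dots> = of_real l * (\<Sum>j\<in>UNIV. cinner (e j) (T (e j)))"
      unfolding norm_a norm_b sum_UNIV_pair by (simp add: UNIV_bool)
    finally show "(\<Sum>c\<in>UNIV. \<Sum>k\<in>UNIV. cinner (\<psi> c k) (T (\<psi> c k)))
        = of_real l * (\<Sum>j\<in>UNIV. cinner (e j) (T (e j)))" .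
  next
    fix r and z :: 'a
    define R where "R c = (\<Sum>k\<in>UNIV. \<Sum>m\<in>UNIV. (pauli r $ m $ k * cinner (\<psi> c k) z) *\<^sub>C \<psi> c m)" for c
    have R: "R (s, t) = (case r of
        z_basis \<Rightarrow> of_real l *\<^sub>C (cinner (b t) z *\<^sub>C a s + cinner (a s) z *\<^sub>C b t)
      | x_basis \<Rightarrow> (of_real l * \<i> * bsign s * bsign t) *\<^sub>C (cinner (a s) z *\<^sub>C b t - cinner (b t) z *\<^sub>C a s))"
      for s t
    proof -
      define X where "X = x (s, t)"
      define Y where "Y = y (s, t)"
      define c where "c = (s, t)"
      note \<psi> = \<psi>1[of c] \<psi>2[of c]
      note \<psi>XY = \<psi>[unfolded c_def, folded X_def Y_def, folded c_def]
      have "R (s, t) = (case r of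
          z_basis \<Rightarrow> cinner Y z *\<^sub>C X + cinner X z *\<^sub>C Y
        | x_basis \<Rightarrow> (\<i> * g c) *\<^sub>C (cinner X z *\<^sub>C Y - cinner Y z *\<^sub>C X))"
      proof (cases r)
        case z_basis
        have "R (s, t) = (cnj h * h) *\<^sub>C (cinner (X + Y) z *\<^sub>C (X + Y))
            - (cnj (d c) * d c) *\<^sub>C (cinner (X - Y) z *\<^sub>C (X - Y))"
          unfolding R_def sum_2 c_def[symmetric] \<psi>XY z_basis
          by (simp add: cinner_scaleC_left scaleC_scaleC mult_ac)
        also have "\<dots> = (1 / 2 + 1 / 2) *\<^sub>C (cinner Y z *\<^sub>C X + cinner X z *\<^sub>C Y)"
          unfolding hd scaleC_add_left
          by (simp add: cinner_add_left cinner_diff_left scaleC_add_left scaleC_add_right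
              cvec.scale_left_diff_distrib cvec.scale_right_diff_distrib)
        finally show ?thesis by (simp add: z_basis)
      next
        case x_basis
        have "R (s, t) = (cnj (d c) * h) *\<^sub>C (cinner (X - Y) z *\<^sub>C (X + Y))
            + (cnj h * d c) *\<^sub>C (cinner (X + Y) z *\<^sub>C (X - Y))"
          unfolding R_def sum_2 c_def[symmetric] \<psi>XY x_basis
          by (simp add: cinner_scaleC_left scaleC_scaleC mult_ac)
        also have "\<dots> = (\<i> * g c / 2 + \<i> * g c / 2) *\<^sub>C (cinner X z *\<^sub>C Y - cinner Y z *\<^sub>C X)"
          unfolding hd scaleC_add_left cvec.scale_minus_left
          by (simp add: cinner_add_left cinner_diff_left scaleC_add_left scaleC_add_right
              cvec.scale_left_diff_distrib cvec.scale_right_diff_distrib)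
        finally show ?thesis by (simp add: x_basis)
      qed
      then show ?thesis
        unfolding X_def Y_def rank1 g_def c_def
        by (cases r) (simp_all add: scaleC_add_right cvec.scale_right_diff_distrib scaleC_scaleC mult_ac)
    qed
    have "(\<Sum>c\<in>UNIV. R c) = (\<Sum>s\<in>UNIV. \<Sum>t\<in>UNIV. R (s, t))"
      by (rule sum_UNIV_pair)
    also have "\<dots> = observable M r z"
      unfolding R by (cases r) (simp_all add: obs_z obs_x)
    finally show "observable M r z =
      (\<Sum>c\<in>UNIV. \<Sum>k\<in>UNIV. \<Sum>m\<in>UNIV. (pauli r $ m $ k * cinner (\<psi> c k) z) *\<^sub>C \<psi> c m)"
      unfolding R_def by simp
  qed
qed

section \<open>Normal form of a symmetric observable of rank two\<close>

lemma positive_op_symmetric: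
  assumes "positive_op A"
  shows "cinner x (A y) = cinner (A x) y"
proof -
  have A: "bounded_clinear A" and pos: "cinner v (A v) \<in> \<real>\<^sub>\<ge>\<^sub>0" for v
    using assms by (auto simp: positive_op_def)
  \<comment> \<open>Polarisation: the sesquilinear defect of symmetry vanishes on the diagonal
    because \<open>cinner v (A v)\<close> is real. Testing \<open>x + y\<close> and
    \<open>x + \<i> *\<^sub>C y\<close> then kills it everywhere.\<close>
  define g where "g u v = cinner u (A v) - cinner (A u) v" for u v
  have g0: "g v v = 0" for v
  proof -
    have "cnj (cinner v (A v)) = cinner v (A v)"
      using pos by (simp add: Reals_cnj_iff[symmetric] nonneg_Reals_Real)
    then show ?thesis unfolding g_def by (metis cinner_commute diff_self)
  qed
  have add: "g (u + v) (u + v) = g u u + g u v + g v u + g v v" for u v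
    by (simp add: g_def bounded_clinear_add[OF A] cinner_add_left cinner_add_right)
  have scale: "g u (c *\<^sub>C v) = c * g u v" "g (c *\<^sub>C v) u = cnj c * g v u" for u v c
    by (simp_all add: g_def bounded_clinear_scaleC[OF A] cinner_scaleC_left cinner_scaleC_right
        right_diff_distrib)
  have "g x y + g y x = 0"
    using add[of x y] by (simp add: g0)
  moreover have "\<i> * g x y - \<i> * g y x = 0"
    using add[of x "\<i> *\<^sub>C y"] by (simp add: g0 scale)
  then have "g x y = g y x" by simp
  ultimately have "g x y = 0" by simp
  then show ?thesis by (simp add: g_def)
qed

text \<open>\<open>cadjoint\<close> is a choice, so some adjoint must first be exhibited; here the
  inverse of \<open>U\<close> is one.\<close>

lemma cadjoint_unitary:
  assumes "unitary_op U"
  shows "cinner (U x) y = cinner x (cadjoint U y)" "cadjoint U (U x) = x" "U (cadjoint U x) = x"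
proof -
  have surj: "surj U" and U: "\<And>x y. cinner (U x) (U y) = cinner x y"
    using assms by (auto simp: unitary_op_def)
  have "\<exists>B. \<forall>x y. cinner (U x) y = cinner x (B y)"
  proof (intro exI allI)
    fix x y
    have "cinner (U x) (U (inv U y)) = cinner x (inv U y)" by (rule U)
    then show "cinner (U x) y = cinner x (inv U y)" by (simp add: surj_f_inv_f[OF surj])
  qed
  then have "\<forall>x y. cinner (U x) y = cinner x (cadjoint U y)"
    unfolding cadjoint_def by (rule someI_ex)
  then show adj: "cinner (U x) y = cinner x (cadjoint U y)" for x y by blast
  show inv1: "cadjoint U (U x) = x" for x
    by (rule cinner_ext_right) (simp add: adj[symmetric] U)
  show "U (cadjoint U x) = x"
    using inv1 surj by (metis surjD)
qed

lemma cinner_eigenvectors_unitary: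
  assumes U: "\<And>x y. cinner (U x) (U y) = cinner x y"
    and eig: "U v = \<mu> *\<^sub>C v" "U w = \<nu> *\<^sub>C w" and "cmod \<mu> = 1" "\<mu> \<noteq> \<nu>"
  shows "cinner v w = 0"
proof -
  have "cinner v w = cnj \<mu> * \<nu> * cinner v w"
    using U[of v w] by (simp add: eig cinner_scaleC_left cinner_scaleC_right mult_ac)
  moreover have "cnj \<mu> * \<nu> \<noteq> 1"
  proof
    assume "cnj \<mu> * \<nu> = 1"
    moreover have "\<mu> * cnj \<mu> = 1" using complex_norm_square[of \<mu>] assms(4) by simp
    ultimately have "\<nu> = \<mu>" by (metis mult.assoc mult_1_left mult_1_right)
    then show False using assms(5) by simp
  qed
  ultimately show ?thesis by (simp add: mult_cancel_right1)
qed

lemma eigenvalue_unitary: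
  assumes U: "\<And>x y. cinner (U x) (U y) = cinner x y" and "U v = \<mu> *\<^sub>C v" "v \<noteq> 0"
  shows "cmod \<mu> = 1"
proof -
  have "cinner v v = (\<mu> * cnj \<mu>) * cinner v v"
    using U[of v v] assms(2) by (simp add: cinner_scaleC_left cinner_scaleC_right mult_ac)
  then have "complex_of_real ((cmod \<mu>)\<^sup>2) = 1"
    using assms(3) unfolding complex_norm_square by (simp add: mult_cancel_right1)
  then have "(cmod \<mu>)\<^sup>2 = 1" by (simp only: of_real_eq_1_iff)
  then show ?thesis using norm_ge_zero[of \<mu>] by (simp add: power2_eq_1_iff)
qed

section \<open>Two-dimensional invariant subspaces and the normal form\<close>

lemma subspace_range_bounded_clinear:
  assumes "bounded_clinear A"
  shows "cvec.subspace (range A)"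
  unfolding cvec.subspace_def
  by (auto simp: bounded_clinear_add[OF assms, symmetric] bounded_clinear_scaleC[OF assms, symmetric])
    (metis bounded_clinear_zero[OF assms] rangeI)

text \<open>Otherwise \<open>x\<close>, \<open>y\<close>, \<open>z\<close> would be three
  independent vectors in the span of a basis with two elements.\<close>

lemma subspace_dim_2_span:
  assumes S: "cvec.dim S = 2" and x: "x \<in> S" "x \<noteq> 0" and y: "y \<in> S" "\<And>c. y \<noteq> c *\<^sub>C x"
    and z: "z \<in> S"
  obtains c d where "z = c *\<^sub>C x + d *\<^sub>C y"
proof -
  obtain B where B: "B \<subseteq> S" "cvec.independent B" "S \<subseteq> cvec.span B" "card B = 2"
    using cvec.basis_exists[of S] S by metis
  have fin: "finite B" using B(4) by (metis card.infinite zero_neq_numeral)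
  have "cvec.independent {x}" using x by simp
  moreover have "y \<notin> cvec.span {x}" using y(2) by (auto simp: cvec.span_singleton)
  ultimately have ind: "cvec.independent {y, x}" by (rule cvec.independent_insertI[rotated])
  have "z \<in> cvec.span {y, x}"
  proof (rule ccontr)
    assume nz: "z \<notin> cvec.span {y, x}"
    then have "cvec.independent {z, y, x}" using ind by (rule cvec.independent_insertI)
    then have "card {z, y, x} \<le> 2"
      using cvec.independent_span_bound[OF fin, of "{z, y, x}"] B x y z by auto
    moreover have "z \<noteq> y" "z \<noteq> x" using nz by (auto intro: cvec.span_base)
    moreover have "y \<noteq> x" using y(2)[of 1] by simp
    ultimately show False by simp
  qed
  then obtain d where "z - d *\<^sub>C y \<in> cvec.span {x}"
    by (auto simp: cvec.span_breakdown_eq)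
  then obtain c where "z - d *\<^sub>C y = c *\<^sub>C x" by (auto simp: cvec.span_singleton)
  then have "z = c *\<^sub>C x + d *\<^sub>C y" by (simp add: algebra_simps)
  then show ?thesis by (rule that)
qed

text \<open>If \<open>x\<close> is no eigenvector, then \<open>x\<close> and \<open>J x\<close> span
  \<open>S\<close>, so \<open>J\<close> satisfies a quadratic equation at \<open>x\<close>.
  Factoring it over the complex numbers gives an eigenvector.\<close>

lemma eigenvector_dim_2:
  fixes J :: "'a::complex_inner \<Rightarrow> 'a"
  assumes dim: "cvec.dim S = 2" and sub: "cvec.subspace S"
    and J: "bounded_clinear J" "\<And>v. v \<in> S \<Longrightarrow> J v \<in> S"
  obtains v \<mu> where "v \<in> S" "v \<noteq> 0" "J v = \<mu> *\<^sub>C v"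
proof -
  have "\<not> S \<subseteq> {0}"
  proof
    assume "S \<subseteq> {0}"
    then have "cvec.dim S \<le> card ({} :: 'a set)" by (intro cvec.dim_le_card) auto
    then show False using dim by simp
  qed
  then obtain x where x: "x \<in> S" "x \<noteq> 0" by blast
  show ?thesis
  proof (cases "\<exists>c. J x = c *\<^sub>C x")
    case True
    then show ?thesis using x that by blast
  next
    case False
    obtain a b where ab: "J (J x) = a *\<^sub>C x + b *\<^sub>C J x"
      using subspace_dim_2_span[OF dim x J(2)[OF x(1)] _ J(2)[OF J(2)[OF x(1)]]] False by metis
    define w where "w = csqrt (b\<^sup>2 + 4 * a)"
    \<comment> \<open>These are the roots of X^2 - b X - a; thus \<open>J - t\<close> annihilates
      the vector \<open>v = J x - u *\<^sub>C x\<close>.\<close>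
    define t u where "t = (b + w) / 2" and "u = (b - w) / 2"
    have "w * w = b\<^sup>2 + 4 * a" by (simp add: w_def flip: power2_eq_square)
    then have tu: "b = t + u" "a = - (t * u)"
      by (auto simp: t_def u_def field_simps power2_eq_square)
    define v where "v = J x - u *\<^sub>C x"
    have "J v = t *\<^sub>C v"
      unfolding v_def bounded_clinear_diff[OF J(1)] bounded_clinear_scaleC[OF J(1)] ab tu
      by (simp add: scaleC_add_left cvec.scale_right_diff_distrib scaleC_scaleC)
    moreover have "v \<noteq> 0" using False by (auto simp: v_def)
    moreover have "v \<in> S"
      unfolding v_def by (intro cvec.subspace_diff cvec.subspace_scale sub J(2) x)
    ultimately show ?thesis using that by blast
  qed
qed

text \<open>
  An operator anticommuting with a unitary \<open>J\<close> exchanges the eigenspaces of \<open>J\<close> for \<open>\<mu>\<close> and \<open>- \<mu>\<close>.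
\<close>

lemma rank_two_normal_form:
  fixes A J :: "'a::complex_inner \<Rightarrow> 'a"
  assumes A: "bounded_clinear A" "\<And>x y. cinner x (A y) = cinner (A x) y"
    and rank: "op_rank A = 2"
    and J: "bounded_clinear J" "\<And>x y. cinner (J x) (J y) = cinner x y"
    and anti: "\<And>x. J (A x) = - A (J x)"
  obtains l p q \<mu> where "l \<ge> 0" "norm p = 1" "norm q = 1" "cinner p q = 0"
    "J p = \<mu> *\<^sub>C p" "J q = (- \<mu>) *\<^sub>C q" "cmod \<mu> = 1"
    "\<And>z. A z = of_real l *\<^sub>C (cinner q z *\<^sub>C p + cinner p z *\<^sub>C q)"
proof -
  let ?S = "range A"
  have dim: "cvec.dim ?S = 2" using rank by (simp add: op_rank_def)
  have sub: "cvec.subspace ?S" by (rule subspace_range_bounded_clinear[OF A(1)])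
  have JS: "J v \<in> ?S" if v: "v \<in> ?S" for v
  proof -
    obtain y where "v = A y" using v by blast
    then have "J v = A (- J y)" using anti[of y] bounded_clinear_scaleC[OF A(1), of "-1" "J y"]
      by simp
    then show ?thesis by blast
  qed
  obtain v \<mu> where v: "v \<in> ?S" "v \<noteq> 0" "J v = \<mu> *\<^sub>C v"
    using eigenvector_dim_2[OF dim sub J(1) JS] by blast
  define p where "p = sgn v"
  have pv: "p = of_real (inverse (norm v)) *\<^sub>C v"
    by (simp only: p_def sgn_div_norm scaleC_of_real)
  have p: "p \<in> ?S" "norm p = 1" "J p = \<mu> *\<^sub>C p"
    subgoal unfolding pv by (rule cvec.subspace_scale[OF sub v(1)])
    subgoal using v(2) by (simp add: p_def norm_sgn)
    subgoal unfolding pv bounded_clinear_scaleC[OF J(1)] v(3) by (simp add: scaleC_scaleC mult.commute)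
    done
  have p0: "p \<noteq> 0" using p(2) by auto
  have mu: "cmod \<mu> = 1" by (rule eigenvalue_unitary[of J p]) (use J(2) p(3) p0 in auto)
  \<comment> \<open>A symmetric operator is injective on its range: a kernel vector is orthogonal to
    the range.\<close>
  have Ap: "A p \<noteq> 0"
  proof
    assume 0: "A p = 0"
    obtain y where "p = A y" using p(1) by blast
    then have "cinner p p = cinner (A p) y" by (metis A(2))
    then show False using 0 p0 by simp
  qed
  define l where "l = norm (A p)"
  define q where "q = of_real (inverse l) *\<^sub>C A p"
  have l: "l > 0" using Ap by (simp add: l_def)
  have Apq: "A p = of_real l *\<^sub>C q"
    using l by (simp add: q_def scaleC_scaleC flip: of_real_mult)
  have q: "q \<in> ?S" "norm q = 1"
    subgoal unfolding q_def by (rule cvec.subspace_scale[OF sub]) simp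
    subgoal using l by (simp add: q_def norm_scaleC l_def norm_inverse)
    done
  have "J (A p) = (- \<mu>) *\<^sub>C A p"
    by (simp add: anti p(3) bounded_clinear_scaleC[OF A(1)])
  then have Jq: "J q = (- \<mu>) *\<^sub>C q"
    unfolding q_def bounded_clinear_scaleC[OF J(1)] by (simp add: scaleC_scaleC mult.commute)
  have mu_neq: "\<mu> \<noteq> - \<mu>" "- \<mu> \<noteq> \<mu>" using mu by (auto simp: eq_neg_iff_add_eq_0)
  have pq: "cinner p q = 0"
    by (rule cinner_eigenvectors_unitary[OF J(2) p(3) Jq mu mu_neq(1)])
  \<comment> \<open>\<open>A\<close> sends \<open>q\<close> back to the eigenspace for \<mu>, which
    is orthogonal to \<open>q\<close>. Hence \<open>A\<close> has no diagonal entry at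
    \<open>q\<close>.\<close>
  have "J (A q) = \<mu> *\<^sub>C A q"
    unfolding anti Jq bounded_clinear_scaleC[OF A(1)] by (simp add: cvec.scale_minus_left)
  then have qAq: "cinner q (A q) = 0"
    using cinner_eigenvectors_unitary[OF J(2) Jq _ _ mu_neq(2)] mu by simp
  have "q \<noteq> c *\<^sub>C p" for c
  proof
    assume "q = c *\<^sub>C p"
    then have "cinner q q = 0"
      using pq by (metis cinner_scaleC_left cinner_scaleC_right mult_zero_right cinner_commute complex_cnj_zero)
    then show False using q(2) by auto
  qed
  note span = subspace_dim_2_span[OF dim p(1) p0 q(1) this]
  have expand: "z = cinner p z *\<^sub>C p + cinner q z *\<^sub>C q" if z: "z \<in> ?S" for z
  proof -
    obtain c d where cd: "z = c *\<^sub>C p + d *\<^sub>C q" using span[OF z] .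
    have "cinner q p = 0" using pq by (subst cinner_commute) simp
    then have "cinner p z = c" "cinner q z = d"
      unfolding cd using pq p(2) q(2) by (simp_all add: cinner_add_right cinner_scaleC_right cinner_self)
    then show ?thesis using cd by simp
  qed
  have Aqp: "A q = of_real l *\<^sub>C p"
  proof -
    have "cinner p (A q) = of_real l"
      unfolding A(2) Apq using q(2) by (simp add: cinner_scaleC_left cinner_self)
    then show ?thesis using expand[of "A q"] qAq by simp
  qed
  have "A z = of_real l *\<^sub>C (cinner q z *\<^sub>C p + cinner p z *\<^sub>C q)" for z
  proof -
    have "A z = cinner (A p) z *\<^sub>C p + cinner (A q) z *\<^sub>C q"
      using expand[of "A z"] by (simp add: A(2))
    then show ?thesis
      by (simp add: Apq Aqp cinner_scaleC_left scaleC_add_right scaleC_scaleC)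
  qed
  then show ?thesis using that[of l p q \<mu>] l p q(2) pq Jq mu by simp
qed

text \<open>On \<open>p\<close> the square of \<open>V\<close> is the identity, on \<open>q\<close>
  its negative, so the eigencomponents of \<open>p\<close> have eigenvalues 1 and -1 and those of
  \<open>q\<close> have \<i> and -\<i>. These four components form the cycle.\<close>

lemma squash_operator_rotated_observable:
  fixes M :: "bb84_basis \<times> bit \<Rightarrow> 'a::chilbert_space \<Rightarrow> 'a"
  assumes V: "bounded_clinear V" "\<And>x y. cinner (V x) (V y) = cinner x y"
    and p: "norm p = 1" "V (V p) = p" and q: "norm q = 1" "V (V q) = - q"
    and l: "0 \<le> l" "l \<le> 1"
    and Mz: "\<And>z. observable M z_basis z = of_real l *\<^sub>C (cinner q z *\<^sub>C p + cinner p z *\<^sub>C q)"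
    and Mx: "\<And>z. observable M x_basis z
      = of_real l *\<^sub>C (cinner (V q) z *\<^sub>C V p + cinner (V p) z *\<^sub>C V q)"
  shows "\<exists>F. squash_operator M F"
proof -
  \<comment> \<open>These are the spectral components: \<open>p\<close> is the sum of the
    \<open>a s\<close> and \<open>q\<close> the sum of the \<open>b t\<close>, while
    \<open>V p\<close> and \<open>V q\<close> are recovered from their differences.\<close>
  define a where "a s = (1 / 2) *\<^sub>C (p + bsign s *\<^sub>C V p)" for s
  define b where "b t = (1 / 2) *\<^sub>C (q - (\<i> * bsign t) *\<^sub>C V q)" for t
  have Va: "V (a s) = bsign s *\<^sub>C a s" for s
    by (simp add: a_def bounded_clinear_scaleC[OF V(1)] bounded_clinear_add[OF V(1)]
        bounded_clinear_diff[OF V(1)] p(2) scaleC_add_right cvec.scale_right_diff_distrib scaleC_scaleC)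
  have Vb: "V (b t) = (\<i> * bsign t) *\<^sub>C b t" for t
    by (simp add: b_def bounded_clinear_scaleC[OF V(1)] bounded_clinear_add[OF V(1)]
        bounded_clinear_diff[OF V(1)] q(2) scaleC_add_right cvec.scale_right_diff_distrib scaleC_scaleC)
  note orth = cinner_eigenvectors_unitary[of V, OF V(2)]
  have orth_a: "cinner (a True) (a False) = 0" by (rule orth[OF Va Va]) auto
  have orth_b: "cinner (b True) (b False) = 0"
    by (rule orth[OF Vb Vb]) (auto simp: norm_mult)
  have orth_ab: "cinner (a s) (b t) = 0" for s t
    by (rule orth[OF Va Vb]) (auto simp: complex_eq_iff)
  have half: "(1 / 2) *\<^sub>C x + (1 / 2) *\<^sub>C x = x" for x :: 'a
    by (simp flip: scaleC_add_left)
  have a_sum: "a True + a False = p" "a True - a False = V p"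
    by (simp_all add: a_def scaleC_add_right cvec.scale_right_diff_distrib half)
  have b_sum: "b True + b False = q" "b True - b False = - (\<i> *\<^sub>C V q)"
    subgoal by (simp add: b_def cvec.scale_right_diff_distrib scaleC_add_right half)
    subgoal using arg_cong[OF half[of "\<i> *\<^sub>C V q"], of uminus]
      by (simp add: b_def cvec.scale_right_diff_distrib scaleC_add_right)
    done
  have pythagoras: "(norm u)\<^sup>2 + (norm v)\<^sup>2 = (norm (u + v))\<^sup>2" if "cinner u v = 0" for u v :: 'a
  proof -
    have "inner u v = 0" using that by (metis Re_cinner zero_complex.simps(1))
    then show ?thesis
      by (simp add: power2_norm_eq_inner inner_add_left inner_add_right inner_commute)
  qed
  have iVq: "\<i> *\<^sub>C (b True - b False) = V q"
    unfolding b_sum cvec.scale_minus_right scaleC_scaleC by (simp add: cvec.scale_minus_left cvec.scale_one)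
  show ?thesis
  proof (rule squash_operator_four_cycle[of a b l])
    show "(\<Sum>s\<in>UNIV. (norm (a s))\<^sup>2) = 1"
      using pythagoras[OF orth_a] unfolding a_sum p(1) by (simp add: UNIV_bool add.commute)
    show "(\<Sum>s\<in>UNIV. (norm (b s))\<^sup>2) = 1"
      using pythagoras[OF orth_b] unfolding b_sum q(1) by (simp add: UNIV_bool add.commute)
    fix z
    show "observable M z_basis z = (\<Sum>s\<in>UNIV. \<Sum>t\<in>UNIV.
      of_real l *\<^sub>C (cinner (b t) z *\<^sub>C a s + cinner (a s) z *\<^sub>C b t))"
      unfolding Mz a_sum(1)[symmetric] b_sum(1)[symmetric]
      by (simp add: UNIV_bool cinner_add_left scaleC_add_left scaleC_add_right)
    show "observable M x_basis z = (\<Sum>s\<in>UNIV. \<Sum>t\<in>UNIV.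
      (of_real l * \<i> * bsign s * bsign t) *\<^sub>C (cinner (a s) z *\<^sub>C b t - cinner (b t) z *\<^sub>C a s))"
      unfolding Mx iVq[symmetric] a_sum(2)[symmetric]
      by (simp add: UNIV_bool cinner_diff_left cinner_scaleC_left scaleC_add_left scaleC_add_right
          cvec.scale_left_diff_distrib cvec.scale_right_diff_distrib scaleC_scaleC algebra_simps)
  qed (use orth_a orth_b orth_ab l in auto)
qed

theorem theorem1:
  fixes M :: "bb84_basis \<times> bit \<Rightarrow> 'a::chilbert_space \<Rightarrow> 'a"
  assumes povm: "bb84_povm M"
    and symm: "c4_symmetric M"
    and rank: "op_rank (observable M z_basis) = 2"
  shows "\<exists>F. squash_operator M F"
proof -
  obtain U where U: "unitary_op U"
    and rot: "\<And>b. U \<circ> M (z_basis, b) \<circ> cadjoint U = M (x_basis, b)"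
    and flip: "\<And>r b. U ^^ 2 \<circ> M (r, b) \<circ> cadjoint U ^^ 2 = M (r, 1 - b)"
    using symm unfolding c4_symmetric_def by blast
  have Ulin: "bounded_clinear U" and iso: "cinner (U x) (U y) = cinner x y" for x y
    using U by (auto simp: unitary_op_def)
  note adj = cadjoint_unitary[OF U]
  have pos: "positive_op (M (r, b))" for r b
    using povm by (simp add: bb84_povm_def)
  have sum1: "M (r, 0) x + M (r, 1) x = x" for r x
    using povm by (metis (no_types, lifting) bb84_povm_def id_apply)
  define A where "A = observable M z_basis"
  have Alin: "bounded_clinear A"
    using pos unfolding A_def observable_def positive_op_def bounded_clinear_def
    by (auto intro: bounded_linear_sub simp: cvec.scale_right_diff_distrib)
  have Asym: "cinner x (A y) = cinner (A x) y" for x y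
    using positive_op_symmetric[OF pos]
    by (simp add: A_def observable_def cinner_diff_left cinner_diff_right)
  define J where "J = (\<lambda>x. U (U x))"
  have Jlin: "bounded_clinear J"
    using Ulin unfolding J_def bounded_clinear_def by (auto intro: bounded_linear_compose)
  have Jiso: "cinner (J x) (J y) = cinner x y" for x y
    by (simp add: J_def iso)
  \<comment> \<open>The flip identity is evaluated at \<open>J x\<close>, where the two adjoints
    undo \<open>J\<close>.\<close>
  have JM: "J (M (r, b) x) = M (r, 1 - b) (J x)" for r b x
    using fun_cong[OF flip[of r b], of "J x"] by (simp add: J_def numeral_2_eq_2 adj)
  have anti: "J (A x) = - A (J x)" for x
    using JM[of z_basis 0 x] JM[of z_basis 1 x]
    by (simp add: A_def observable_def bounded_clinear_diff[OF Jlin])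
  obtain l p q \<mu> where l: "l \<ge> 0" and p: "norm p = 1" "J p = \<mu> *\<^sub>C p"
    and q: "norm q = 1" "J q = (- \<mu>) *\<^sub>C q" and pq: "cinner p q = 0" and mu: "cmod \<mu> = 1"
    and Aeq: "\<And>z. A z = of_real l *\<^sub>C (cinner q z *\<^sub>C p + cinner p z *\<^sub>C q)"
    using rank_two_normal_form[OF Alin Asym _ Jlin Jiso anti] rank unfolding A_def by metis
  \<comment> \<open>The identity minus \<open>A\<close> is twice \<open>M (z_basis, 1)\<close>,
    hence positive. At \<open>p + q\<close>, of squared norm 2, the form of \<open>A\<close> equals
    \<open>2 * l\<close>.\<close>
  have "l \<le> 1"
  proof -
    have qp: "cinner q p = 0" using pq by (subst cinner_commute) simp
    have "cinner (p + q) (A (p + q)) = of_real (2 * l)"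
      using p(1) q(1) by (simp add: Aeq cinner_add_left cinner_add_right cinner_scaleC_right
          pq qp cinner_self[of p] cinner_self[of q])
    moreover have "cinner (p + q) (p + q) = 2"
      using p(1) q(1) by (simp add: cinner_add_left cinner_add_right pq qp cinner_self[of p] cinner_self[of q])
    moreover have "p + q - A (p + q) = 2 *\<^sub>R M (z_basis, 1) (p + q)"
      using sum1[of z_basis "p + q"] by (simp add: A_def observable_def scaleR_2 algebra_simps)
    ultimately have "2 - of_real (2 * l) = complex_of_real 2 * cinner (p + q) (M (z_basis, 1) (p + q))"
      by (metis cinner_diff_right cinner_scaleR_right)
    then have "complex_of_real (2 - 2 * l) \<in> \<real>\<^sub>\<ge>\<^sub>0"
      using pos[of z_basis 1] by (simp add: positive_op_def)
    then show ?thesis by (simp only: nonneg_Reals_of_real_iff)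
  qed
  \<comment> \<open>A square root of \<mu>: dividing \<open>U\<close> by it makes the eigenvalues of
    the square at \<open>p\<close> and \<open>q\<close> equal to 1 and -1.\<close>
  define \<omega> where "\<omega> = csqrt \<mu>"
  have omega: "\<omega> * \<omega> = \<mu>" by (simp add: \<omega>_def flip: power2_eq_square)
  then have "cmod \<omega> * cmod \<omega> = 1" using mu by (simp flip: norm_mult)
  then have "complex_of_real ((cmod \<omega>)\<^sup>2) = 1" by (simp add: power2_eq_square flip: of_real_mult)
  then have omega1: "\<omega> * cnj \<omega> = 1" by (simp only: complex_norm_square)
  define V where "V = (\<lambda>x. cnj \<omega> *\<^sub>C U x)"
  have Vlin: "bounded_clinear V"
  proof -
    have "bounded_linear (\<lambda>x. cnj \<omega> *\<^sub>C (x :: 'a))"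
      by (rule bounded_linear_intro[of _ "cmod \<omega>"])
        (auto simp: scaleC_add_right norm_scaleC scaleC_of_real[symmetric] scaleC_scaleC mult.commute)
    then have "bounded_linear V"
      using Ulin unfolding V_def bounded_clinear_def by (auto intro: bounded_linear_compose)
    then show ?thesis
      using Ulin by (simp add: bounded_clinear_def V_def scaleC_scaleC mult.commute)
  qed
  \<comment> \<open>The phase cancels in rank-one operators, so \<open>V\<close> may replace
    \<open>U\<close> in rotating the z observable into the x observable.\<close>
  have rank1: "cinner (V x) z *\<^sub>C V y = cinner (U x) z *\<^sub>C U y" for x y z
    using omega1 by (simp add: V_def cinner_scaleC_left scaleC_scaleC mult_ac)
  have VV: "V (V x) = cnj \<mu> *\<^sub>C J x" for x
    by (simp add: V_def J_def bounded_clinear_scaleC[OF Ulin] scaleC_scaleC flip: omega)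
  have mu1: "cnj \<mu> * \<mu> = 1" using complex_norm_square[of \<mu>] mu by (simp add: mult.commute)
  show ?thesis
  proof (rule squash_operator_rotated_observable[OF Vlin _ p(1) _ q(1) _ l \<open>l \<le> 1\<close>])
    show "cinner (V x) (V y) = cinner x y" for x y
      using omega1 by (simp add: V_def cinner_scaleC_left cinner_scaleC_right iso mult_ac flip: mult.assoc)
    show "V (V p) = p" by (simp add: VV p(2) scaleC_scaleC mu1)
    show "V (V q) = - q" by (simp add: VV q(2) scaleC_scaleC mu1)
    show "observable M z_basis z = of_real l *\<^sub>C (cinner q z *\<^sub>C p + cinner p z *\<^sub>C q)" for z
      using Aeq by (simp add: A_def)
    show "observable M x_basis z
      = of_real l *\<^sub>C (cinner (V q) z *\<^sub>C V p + cinner (V p) z *\<^sub>C V q)" for z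
    proof -
      have "observable M x_basis z = U (A (cadjoint U z))"
        using fun_cong[OF rot[of 0], of z] fun_cong[OF rot[of 1], of z]
        by (simp add: A_def observable_def bounded_clinear_diff[OF Ulin])
      also have "\<dots> = of_real l *\<^sub>C (cinner (U q) z *\<^sub>C U p + cinner (U p) z *\<^sub>C U q)"
        by (simp add: Aeq adj bounded_clinear_scaleC[OF Ulin] bounded_clinear_add[OF Ulin])
      finally show ?thesis by (simp only: rank1)
    qed
  qed
qed

end
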